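(* Let $m\ge n$ be positive integers and let $G$ be a non-chordal graph that does not contain $I_m\vee K_n$ as a subgraph and satisfies $\omega(G[\Omega(G)])+i(G)\le m$. Then $G$ has a chordal completion $G^*$ (a chordal spanning supergraph) with $\omega(G^* )<m+n$. Consequently $\chi_{DP}(G)<m+n$.
   Context: All graphs are finite and simple; $\omega$ is the clique number, $\chi_{DP}$ the DP-chromatic number, $I_m$ the edgeless graph on $m$ vertices, and $G_1\vee G_2$ the join (disjoint union plus all edges between $V(G_1)$ and $V(G_2)$). A hole of $G$ is an induced cycle of length at least $4$; $G$ is chordal if it has no hole. $\mathcal H(G)$ is the set of holes, $\mathcal H(G,u)$ those containing $u$, and $\Omega(G)=\bigcup_{H\in\mathcal H(G)}V(H)$. A hole cover of $G$ is a nonempty $X\subseteq V(G)$ meeting every hole (any nonempty set if $G$ is chordal). A vertex $u$ satisfies the NC property in $G$ if there are no holes $H\in\mathcal H(G,u)$, $H'\in\mathcal H(G)\setminus\mathcal H(G,u)$ sharing two consecutive edges (two distinct edges with a common end vertex lying on both). A set $\mathcal C$ satisfies the NC property in $G$ if each of its vertices does and every hole contains at most one vertex of $\mathcal C$. Locally chordalizing all holes in $\mathcal H(G,u)$ by $u$ means adding all edges $uw$ with $w\ne u$ lying on some hole in $\mathcal H(G,u)$. For a hole cover $\mathcal C=\{u_1,\dots,u_k\}$ satisfying the NC property in $G$, set $G_0=G$, obtain $G_i$ from $G_{i-1}$ by locally chordalizing all holes in $\mathcal H(G_{i-1},u_i)$ by $u_i$, and put $\widehat G(\mathcal C)=G_k$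 (independent of the ordering). Given a hole cover $\mathcal C$ of $G$, an ordered partition $(\mathcal C_1,\dots,\mathcal C_\ell)$ of $\mathcal C$ into nonempty parts is a local chordalization partition if, with $G_0=G_0^*=G-\mathcal C$ and, for $i=1,\dots,\ell$, $G_i$ the graph with $V(G_i)=V(G_{i-1}^* )\cup\mathcal C_i$ and $E(G_i)=E(G_{i-1}^* )\cup E\big(G-\bigcup_{j=i+1}^{\ell}\mathcal C_j\big)$ and $G_i^*=\widehat{G_i}(\mathcal C_i)$, each $\mathcal C_i$ is a hole cover of $G_i$ satisfying the NC property in $G_i$ and each $G_i^*$ is chordal. The non-chordality index $i(G)$ is $0$ if $G$ is chordal and otherwise the smallest $\ell$ such that some hole cover of $G$ admits a local chordalization partition with $\ell$ parts. *)

theory Defs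
  imports Main "HOL-Library.Extended_Nat"
begin

type_synonym 'a graph = "'a set \<times> 'a set set"

definition verts :: "'a graph \<Rightarrow> 'a set" where "verts G = fst G"
definition edges :: "'a graph \<Rightarrow> 'a set set" where "edges G = snd G"

definition wf_graph :: "'a graph \<Rightarrow> bool" where
  "wf_graph G \<longleftrightarrow> finite (verts G) \<and>
     (\<forall>e\<in>edges G. \<exists>u v. u \<noteq> v \<and> e = {u, v} \<and> u \<in> verts G \<and> v \<in> verts G)"

definition adj :: "'a graph \<Rightarrow> 'a \<Rightarrow> 'a \<Rightarrow> bool" where
  "adj G u v \<longleftrightarrow> u \<noteq> v \<and> {u, v} \<in> edges G"

definition induced :: "'a graph \<Rightarrow> 'a set \<Rightarrow> 'a graph" where
  "induced G S = (verts G \<inter> S, {e \<in> edges G. e \<subseteq> S})"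

definition delete :: "'a graph \<Rightarrow> 'a set \<Rightarrow> 'a graph" where
  "delete G S = (verts G - S, {e \<in> edges G. e \<inter> S = {}})"

definition is_clique :: "'a graph \<Rightarrow> 'a set \<Rightarrow> bool" where
  "is_clique G K \<longleftrightarrow> K \<subseteq> verts G \<and> (\<forall>u\<in>K. \<forall>v\<in>K. u \<noteq> v \<longrightarrow> adj G u v)"

definition clique_num :: "'a graph \<Rightarrow> nat" where
  "clique_num G = Max {card K | K. is_clique G K}"

text \<open>A hole: the vertex set of an induced cycle of length at least 4
  (an induced cycle is determined by its vertex set).\<close>
definition is_hole :: "'a graph \<Rightarrow> 'a set \<Rightarrow> bool" where
  "is_hole G H \<longleftrightarrow> H \<subseteq> verts G \<and>
     (\<exists>xs. distinct xs \<and> set xs = H \<and> length xs \<ge> 4 \<and>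
        (\<forall>i < length xs. \<forall>j < length xs.
            adj G (xs ! i) (xs ! j) \<longleftrightarrow>
              (j = Suc i mod length xs \<or> i = Suc j mod length xs)))"

definition chordal :: "'a graph \<Rightarrow> bool" where
  "chordal G \<longleftrightarrow> (\<nexists>H. is_hole G H)"

definition Omega :: "'a graph \<Rightarrow> 'a set" where
  "Omega G = \<Union> {H. is_hole G H}"

definition hole_cover :: "'a graph \<Rightarrow> 'a set \<Rightarrow> bool" where
  "hole_cover G X \<longleftrightarrow> X \<noteq> {} \<and> X \<subseteq> verts G \<and> (\<forall>H. is_hole G H \<longrightarrow> H \<inter> X \<noteq> {})"

definition hole_edges :: "'a graph \<Rightarrow> 'a set \<Rightarrow> 'a set set" where
  "hole_edges G H = {e \<in> edges G. e \<subseteq> H}"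

definition NC_vertex :: "'a graph \<Rightarrow> 'a \<Rightarrow> bool" where
  "NC_vertex G u \<longleftrightarrow>
     \<not> (\<exists>H H' x y z. is_hole G H \<and> u \<in> H \<and> is_hole G H' \<and> u \<notin> H' \<and> x \<noteq> z \<and>
          {x, y} \<in> hole_edges G H \<and> {y, z} \<in> hole_edges G H \<and>
          {x, y} \<in> hole_edges G H' \<and> {y, z} \<in> hole_edges G H')"

definition NC_set :: "'a graph \<Rightarrow> 'a set \<Rightarrow> bool" where
  "NC_set G C \<longleftrightarrow> (\<forall>u\<in>C. NC_vertex G u) \<and> (\<forall>H. is_hole G H \<longrightarrow> card (H \<inter> C) \<le> 1)"

definition local_chordalize :: "'a graph \<Rightarrow> 'a \<Rightarrow> 'a graph" where
  "local_chordalize G u =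
     (verts G, edges G \<union> {{u, w} | w. w \<noteq> u \<and> (\<exists>H. is_hole G H \<and> u \<in> H \<and> w \<in> H)})"

text \<open>\<widehat>G(C): sequential local chordalization along an enumeration of C
  (the result is independent of the ordering, so any enumeration is taken).\<close>
definition hat :: "'a graph \<Rightarrow> 'a set \<Rightarrow> 'a graph" where
  "hat G C = foldl local_chordalize G (SOME xs. distinct xs \<and> set xs = C)"

text \<open>Checking the local chordalization partition conditions; the second argument is
  G^*_{i-1}, the list is (C_i, ..., C_l).\<close>
fun lcp_ok :: "'a graph \<Rightarrow> 'a graph \<Rightarrow> 'a set list \<Rightarrow> bool" where
  "lcp_ok G Gs [] = True"
| "lcp_ok G Gs (Ci # rest) =
     (let Gi = (verts Gs \<union> Ci, edges Gs \<union> edges (delete G (\<Union> (set rest))));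
          Gis = hat Gi Ci
      in hole_cover Gi Ci \<and> NC_set Gi Ci \<and> chordal Gis \<and> lcp_ok G Gis rest)"

definition local_chordalization_partition :: "'a graph \<Rightarrow> 'a set \<Rightarrow> 'a set list \<Rightarrow> bool" where
  "local_chordalization_partition G C Cs \<longleftrightarrow>
     hole_cover G C \<and> Cs \<noteq> [] \<and> (\<forall>X\<in>set Cs. X \<noteq> {}) \<and> \<Union> (set Cs) = C \<and>
     (\<forall>i < length Cs. \<forall>j < length Cs. i \<noteq> j \<longrightarrow> Cs ! i \<inter> Cs ! j = {}) \<and>
     lcp_ok G (delete G C) Cs"

text \<open>Non-chordality index i(G); it is \<infinity> if no local chordalization partition exists.\<close>
definition nc_index :: "'a graph \<Rightarrow> enat" where
  "nc_index G = (if chordal G then 0 else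
     Inf {enat l | l. \<exists>C Cs. length Cs = l \<and> local_chordalization_partition G C Cs})"

text \<open>G contains I_m \<or> K_n as a (not necessarily induced) subgraph.\<close>
definition contains_join :: "'a graph \<Rightarrow> nat \<Rightarrow> nat \<Rightarrow> bool" where
  "contains_join G m n \<longleftrightarrow> (\<exists>A B. A \<subseteq> verts G \<and> B \<subseteq> verts G \<and> A \<inter> B = {} \<and>
      card A = m \<and> card B = n \<and> is_clique G B \<and> (\<forall>a\<in>A. \<forall>b\<in>B. adj G a b))"

definition chordal_completion :: "'a graph \<Rightarrow> 'a graph \<Rightarrow> bool" where
  "chordal_completion G Gs \<longleftrightarrow> wf_graph Gs \<and> verts Gs = verts G \<and> edges G \<subseteq> edges Gs \<and> chordal Gs"

text \<open>DP-colouring (correspondence colouring). A k-fold cover assigns to every edge uv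
  a (partial) matching M u v between the colour sets {0..<k} of u and of v.\<close>
definition dp_cover :: "'a graph \<Rightarrow> nat \<Rightarrow> ('a \<Rightarrow> 'a \<Rightarrow> nat \<Rightarrow> nat \<Rightarrow> bool) \<Rightarrow> bool" where
  "dp_cover G k M \<longleftrightarrow> (\<forall>u v. adj G u v \<longrightarrow>
      (\<forall>i j. M u v i j \<longrightarrow> i < k \<and> j < k) \<and>
      (\<forall>i j. M u v i j \<longleftrightarrow> M v u j i) \<and>
      (\<forall>i j j'. M u v i j \<and> M u v i j' \<longrightarrow> j = j'))"

definition dp_colorable :: "'a graph \<Rightarrow> nat \<Rightarrow> bool" where
  "dp_colorable G k \<longleftrightarrow> (\<forall>M. dp_cover G k M \<longrightarrow>
      (\<exists>f. (\<forall>v\<in>verts G. f v < k) \<and> (\<forall>u v. adj G u v \<longrightarrow> \<not> M u v (f u) (f v))))"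

definition chi_DP :: "'a graph \<Rightarrow> nat" where
  "chi_DP G = (LEAST k. dp_colorable G k)"

end

theory Submission
  imports Defs
begin

text \<open>Let \<open>G\<^sup>*\<close> be the last graph of a local chordalization partition with \<open>i(G)\<close> parts.
  The NC property has two consequences. First, chordalizing by \<open>u\<close> creates no new hole: the
  attachments of a connected set \<open>D\<close> that has no vertex adjacent to \<open>u\<close> or on a hole with \<open>u\<close>
  form a clique among the neighbours of \<open>u\<close> in the new graph. Second, in a clique of the
  chordalization all new edges share one vertex. So a clique of \<open>G\<^sup>*\<close> becomes a clique of \<open>G\<close>
  after deleting at most \<open>i(G)\<close> vertices. Moreover adding chords inside holes does not enlarge
  \<open>\<Omega>\<close>, so all new edges lie inside \<open>\<Omega>(G)\<close>, and a clique \<open>K\<close> of \<open>G\<^sup>*\<close> has at most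
  \<open>\<omega>(G[\<Omega>(G)]) + i(G) \<le> m\<close> vertices in \<open>\<Omega>(G)\<close>. If \<open>K\<close> had \<open>m + n\<close> vertices, then \<open>n\<close> of them
  outside \<open>\<Omega>(G)\<close> and \<open>m\<close> others would form \<open>I\<^sub>m \<or> K\<^sub>n\<close> in \<open>G\<close>. Greedy colouring along a perfect
  elimination ordering of \<open>G\<^sup>*\<close> bounds the DP-chromatic number.\<close>

section \<open>Induced paths and holes\<close>

text \<open>An induced path as the list of its vertices in order, by recursion so that paths can be
  grown and cut with list operations. The empty list and single vertices count as paths; for
  \<open>xs = []\<close> the condition on neighbours is void.\<close>

fun ipath :: "'a graph \<Rightarrow> 'a list \<Rightarrow> bool" where
  "ipath G [] = True"
| "ipath G (x # xs) = (ipath G xs \<and> x \<notin> set xs \<and> (\<forall>y\<in>set xs. adj G x y \<longleftrightarrow> y = hd xs))"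

text \<open>A hole cut open at \<open>u\<close>: the bound 3 on \<open>ps\<close> is the bound 4 on
  the cycle. This trades modular indices for lists and singles out the vertex by which the hole is
  chordalized.\<close>

definition cyc :: "'a graph \<Rightarrow> 'a \<Rightarrow> 'a list \<Rightarrow> bool" where
  "cyc G u ps \<longleftrightarrow> ipath G ps \<and> 3 \<le> length ps \<and> u \<notin> set ps \<and>
     (\<forall>w\<in>set ps. adj G u w \<longleftrightarrow> w = hd ps \<or> w = last ps)"

text \<open>Closed neighbourhood of \<open>S\<close>. Equality is included because the arcs compared
  below may share a vertex as well as be joined by an edge.\<close>

definition touch :: "'a graph \<Rightarrow> 'a \<Rightarrow> 'a set \<Rightarrow> bool" where
  "touch G w S \<longleftrightarrow> (\<exists>s\<in>S. w = s \<or> adj G w s)"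

lemma adj_sym: "adj G x y \<longleftrightarrow> adj G y x"
  by (auto simp: adj_def insert_commute)

lemma adj_irrefl [simp]: "\<not> adj G x x"
  by (simp add: adj_def)

lemma adj_verts: "wf_graph G \<Longrightarrow> adj G x y \<Longrightarrow> x \<in> verts G \<and> y \<in> verts G"
  unfolding wf_graph_def adj_def by (metis doubleton_eq_iff)

text \<open>The rule for cutting and gluing: the only edge between the two pieces joins the end of
  the first to the head of the second. An empty piece makes the cross condition void.\<close>

lemma ipath_append:
  "ipath G (xs @ ys) \<longleftrightarrow> ipath G xs \<and> ipath G ys \<and> set xs \<inter> set ys = {} \<and>
     (\<forall>x\<in>set xs. \<forall>y\<in>set ys. adj G x y \<longleftrightarrow> x = last xs \<and> y = hd ys)"
proof (induction xs)
  case (Cons x xs)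
  show ?case
  proof (cases xs)
    case Nil
    then show ?thesis by auto
  next
    case (Cons a list)
    have ne: "xs \<noteq> []" using Cons by simp
    have h: "hd (xs @ ys) = hd xs" "last (x # xs) = last xs" "hd xs \<in> set xs" "last xs \<in> set xs"
      using ne by auto
    have "ipath G ((x # xs) @ ys) \<longleftrightarrow>
       ipath G (xs @ ys) \<and> x \<notin> set xs \<union> set ys \<and> (\<forall>y\<in>set xs \<union> set ys. adj G x y \<longleftrightarrow> y = hd xs)"
      using h by simp
    also have "\<dots> \<longleftrightarrow> ipath G (x # xs) \<and> ipath G ys \<and> set (x # xs) \<inter> set ys = {} \<and>
     (\<forall>z\<in>set (x # xs). \<forall>y\<in>set ys. adj G z y \<longleftrightarrow> z = last (x # xs) \<and> y = hd ys)"
    proof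
      assume A: "ipath G (xs @ ys) \<and> x \<notin> set xs \<union> set ys \<and> (\<forall>y\<in>set xs \<union> set ys. adj G x y \<longleftrightarrow> y = hd xs)"
      show "ipath G (x # xs) \<and> ipath G ys \<and> set (x # xs) \<inter> set ys = {} \<and>
        (\<forall>z\<in>set (x # xs). \<forall>y\<in>set ys. adj G z y \<longleftrightarrow> z = last (x # xs) \<and> y = hd ys)"
        using A h unfolding Cons.IH by (auto simp del: last.simps)
    next
      assume B: "ipath G (x # xs) \<and> ipath G ys \<and> set (x # xs) \<inter> set ys = {} \<and>
        (\<forall>z\<in>set (x # xs). \<forall>y\<in>set ys. adj G z y \<longleftrightarrow> z = last (x # xs) \<and> y = hd ys)"
      show "ipath G (xs @ ys) \<and> x \<notin> set xs \<union> set ys \<and> (\<forall>y\<in>set xs \<union> set ys. adj G x y \<longleftrightarrow> y = hd xs)"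
        using B h unfolding Cons.IH by (auto simp del: last.simps)
    qed
    finally show ?thesis .
  qed
qed simp

lemma ipath_rev: "ipath G (rev xs) \<longleftrightarrow> ipath G xs"
proof (induction xs)
  case (Cons x xs)
  show ?case
    by (cases "xs = []") (auto simp: ipath_append Cons.IH adj_sym last_rev)
qed simp

lemma ipath_distinct: "ipath G xs \<Longrightarrow> distinct xs"
  by (induction xs) auto

lemma ipath_nth:
  assumes "ipath G xs" "i < length xs" "j < length xs"
  shows "adj G (xs ! i) (xs ! j) \<longleftrightarrow> j = Suc i \<or> i = Suc j"
  using assms
proof (induction xs arbitrary: i j)
  case (Cons x xs)
  have a0: "adj G x (xs ! k) \<longleftrightarrow> k = 0" if "k < length xs" for k
  proof -
    have "xs \<noteq> []" using that by auto
    then have "xs ! k = hd xs \<longleftrightarrow> k = 0"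
      using that ipath_distinct[of G xs] Cons.prems(1)
      by (metis hd_conv_nth ipath.simps(2) length_greater_0_conv nth_eq_iff_index_eq)
    then show ?thesis using Cons.prems(1) that by auto
  qed
  have a1: "adj G (xs ! k) x \<longleftrightarrow> k = 0" if "k < length xs" for k
    using a0[OF that] by (simp add: adj_sym)
  show ?case
    using Cons a0 a1 by (cases i; cases j) auto
qed simp

lemma ipathI_nth:
  assumes "distinct xs"
    and "\<And>i j. i < length xs \<Longrightarrow> j < length xs \<Longrightarrow> adj G (xs ! i) (xs ! j) \<longleftrightarrow> j = Suc i \<or> i = Suc j"
  shows "ipath G xs"
  using assms
proof (induction xs)
  case (Cons x xs)
  have "ipath G xs"
  proof (rule Cons.IH)
    show "distinct xs" using Cons.prems(1) by simp
    fix i j assume "i < length xs" "j < length xs"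
    then show "adj G (xs ! i) (xs ! j) \<longleftrightarrow> j = Suc i \<or> i = Suc j"
      using Cons.prems(2)[of "Suc i" "Suc j"] by simp
  qed
  moreover have "adj G x y \<longleftrightarrow> y = hd xs" if "y \<in> set xs" for y
  proof -
    from that obtain k where "k < length xs" "xs ! k = y" unfolding in_set_conv_nth by (elim exE conjE)
    then have k: "k < length xs" "y = xs ! k" by (simp_all only:)
    then have "adj G x y \<longleftrightarrow> k = 0" using Cons.prems(2)[of 0 "Suc k"] by simp
    moreover have "xs \<noteq> []" "distinct xs" using k(1) Cons.prems(1) by auto
    then have "y = hd xs \<longleftrightarrow> k = 0"
      using k nth_eq_iff_index_eq[of xs k 0] by (simp add: hd_conv_nth)
    ultimately show ?thesis by simp
  qed
  ultimately show ?case using Cons.prems(1) by auto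
qed simp

section \<open>Translation between holes with cyclic indices and cycles cut open at a vertex\<close>

lemma Suc_mod_if: "i < n \<Longrightarrow> Suc i mod n = (if Suc i = n then 0 else Suc i)"
  by auto

lemma cyc_nth:
  assumes c: "cyc G x ps"
  defines "xs \<equiv> x # ps"
  assumes "i < length xs" "j < length xs"
  shows "adj G (xs ! i) (xs ! j) \<longleftrightarrow> j = Suc i mod length xs \<or> i = Suc j mod length xs"
proof -
  have ip: "ipath G ps" and l: "3 \<le> length ps" using c by (auto simp: cyc_def)
  have d: "distinct ps" using ip by (rule ipath_distinct)
  have ne: "ps \<noteq> []" using l by auto
  have a: "adj G x (ps ! k) \<longleftrightarrow> k = 0 \<or> Suc k = length ps" if "k < length ps" for k
  proof -
    have "ps ! k = hd ps \<longleftrightarrow> k = 0" "ps ! k = last ps \<longleftrightarrow> Suc k = length ps"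
      using d that ne by (auto simp: hd_conv_nth last_conv_nth nth_eq_iff_index_eq)
    then show ?thesis using c that by (auto simp: cyc_def)
  qed
  have b: "adj G (ps ! k) x \<longleftrightarrow> k = 0 \<or> Suc k = length ps" if "k < length ps" for k
    using a[OF that] by (simp add: adj_sym)
  show ?thesis
    using assms(3,4) a b ipath_nth[OF ip] l
    by (cases i; cases j) (auto simp: Suc_mod_if xs_def)
qed

text \<open>Every vertex of the cycle has a neighbour on it, so well-formedness supplies membership
  in \<open>verts G\<close>, about which \<open>cyc\<close> says nothing.\<close>

lemma cyc_is_hole:
  assumes wf: "wf_graph G" and c: "cyc G x ps"
  shows "is_hole G (insert x (set ps))"
proof -
  let ?xs = "x # ps"
  have ip: "ipath G ps" and l: "3 \<le> length ps" using c by (auto simp: cyc_def)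
  have "y \<in> verts G" if "y \<in> set ?xs" for y
  proof -
    from that obtain i where "i < length ?xs" "?xs ! i = y" unfolding in_set_conv_nth by (elim exE conjE)
    then have i: "i < length ?xs" "y = ?xs ! i" by (simp_all only:)
    have "Suc i mod length ?xs < length ?xs" by simp
    then have "adj G y (?xs ! (Suc i mod length ?xs))"
      using cyc_nth[OF c i(1)] i(2) by blast
    then show ?thesis using adj_verts[OF wf] by blast
  qed
  then have "insert x (set ps) \<subseteq> verts G" by auto
  moreover have "distinct ?xs" using c ipath_distinct[OF ip] by (simp add: cyc_def)
  ultimately show ?thesis
    unfolding is_hole_def using cyc_nth[OF c] l
    by (intro conjI exI[of _ ?xs]) auto
qed

lemma hole_Cons_cyc:
  assumes d: "distinct (x # ps)" and l: "3 \<le> length ps"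
    and a: "\<And>i j. i < length (x # ps) \<Longrightarrow> j < length (x # ps) \<Longrightarrow> adj G ((x # ps) ! i) ((x # ps) ! j) \<longleftrightarrow>
              (j = Suc i mod length (x # ps) \<or> i = Suc j mod length (x # ps))"
  shows "cyc G x ps"
proof -
  have ne: "ps \<noteq> []" using l by auto
  have m: "Suc k mod length (x # ps) = (if k = length ps then 0 else Suc k)" if "k < length (x # ps)" for k
    using that Suc_mod_if[of k "length (x # ps)"] by simp
  have "ipath G ps"
  proof (rule ipathI_nth)
    show "distinct ps" using d by simp
    fix i j assume ij: "i < length ps" "j < length ps"
    have "adj G (ps ! i) (ps ! j) \<longleftrightarrow> Suc j = (if Suc i = length ps then 0 else Suc (Suc i)) \<or>
        Suc i = (if Suc j = length ps then 0 else Suc (Suc j))"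
      using a[of "Suc i" "Suc j"] m[of "Suc i"] m[of "Suc j"] ij by simp
    then show "adj G (ps ! i) (ps ! j) \<longleftrightarrow> j = Suc i \<or> i = Suc j"
      using ij by (auto split: if_splits)
  qed
  moreover have "adj G x w \<longleftrightarrow> w = hd ps \<or> w = last ps" if "w \<in> set ps" for w
  proof -
    from that obtain k where "k < length ps" "ps ! k = w" unfolding in_set_conv_nth by (elim exE conjE)
    then have k: "k < length ps" "w = ps ! k" by (simp_all only:)
    have "w = hd ps \<longleftrightarrow> k = 0" "w = last ps \<longleftrightarrow> Suc k = length ps"
      using d k ne by (auto simp: hd_conv_nth last_conv_nth nth_eq_iff_index_eq)
    moreover have "adj G x w \<longleftrightarrow> k = 0 \<or> Suc k = length ps"
      using a[of 0 "Suc k"] m[of 0] m[of "Suc k"] k l by auto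
    ultimately show ?thesis by simp
  qed
  ultimately show ?thesis using d l by (simp add: cyc_def)
qed

text \<open>Read cyclically from \<open>u\<close>, the sequence \<open>x, as, u, bs\<close> becomes
  \<open>u, bs, x, as\<close>; so a hole can be cut open at any of its vertices.\<close>

lemma cyc_rotate:
  assumes "cyc G x (as @ u # bs)"
  shows "cyc G u (bs @ x # as)"
proof -
  let ?p = "as @ u # bs"
  have ip: "ipath G ?p" and l: "3 \<le> length ?p" and x: "x \<notin> set ?p"
    and ax: "\<forall>w\<in>set ?p. adj G x w \<longleftrightarrow> w = hd ?p \<or> w = last ?p"
    using assms unfolding cyc_def by blast+
  have ia: "ipath G as" and ib: "ipath G bs" and dis: "set as \<inter> set bs = {}" "u \<notin> set as" "u \<notin> set bs"
    and ub: "\<forall>b\<in>set bs. adj G u b \<longleftrightarrow> b = hd bs"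
    and au: "\<forall>a\<in>set as. adj G a u \<longleftrightarrow> a = last as"
    and ab: "\<forall>a\<in>set as. \<forall>b\<in>set bs. \<not> adj G a b"
    using ip by (auto simp: ipath_append)
  have xa: "adj G x a \<longleftrightarrow> a = hd as" if "a \<in> set as" for a
  proof -
    have "hd ?p = hd as" using that by (cases as) auto
    moreover have "a \<in> set ?p" using that by simp
    ultimately have "adj G x a \<longleftrightarrow> a = hd as \<or> a = last ?p" using ax by metis
    moreover have "last ?p \<in> insert u (set bs)" by auto
    then have "a \<noteq> last ?p" using that dis by (metis disjoint_iff insertE)
    ultimately show ?thesis by simp
  qed
  have xb: "adj G b x \<longleftrightarrow> b = last bs" if "b \<in> set bs" for b
  proof -
    have "last ?p = last bs" using that by (cases bs) auto
    moreover have "b \<in> set ?p" using that by simp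
    ultimately have "adj G x b \<longleftrightarrow> b = hd ?p \<or> b = last bs" using ax by metis
    moreover have "b \<noteq> hd ?p" using that dis by (cases as) auto
    ultimately show ?thesis using adj_sym by metis
  qed
  have ba: "\<not> adj G b a" if "a \<in> set as" "b \<in> set bs" for a b
    using ab that adj_sym by metis
  have ip': "ipath G (bs @ x # as)"
    unfolding ipath_append ipath.simps using ia ib x xa xb ba dis by auto
  have ux: "adj G u x \<longleftrightarrow> as = [] \<or> bs = []"
  proof -
    have "u = hd ?p \<longleftrightarrow> as = []" using dis by (cases as) auto
    moreover have "u = last ?p \<longleftrightarrow> bs = []" using dis last_in_set[of bs] by (cases "bs = []") auto
    moreover have "u \<in> set ?p" by simp
    ultimately show ?thesis using ax adj_sym[of G u x] by metis
  qed
  have "adj G u w \<longleftrightarrow> w = hd (bs @ x # as) \<or> w = last (bs @ x # as)" if w: "w \<in> set (bs @ x # as)" for w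
  proof -
    consider "w \<in> set bs" | "w = x" | "w \<in> set as" using w by auto
    then show ?thesis
    proof cases
      case 1
      have "w \<noteq> last (x # as)" using 1 x dis last_in_set[of "x # as"] by auto
      then show ?thesis using 1 ub by (cases bs) auto
    next
      case 2
      have "x = hd (bs @ x # as) \<longleftrightarrow> bs = []" using x by (cases bs) auto
      moreover have "x = last (bs @ x # as) \<longleftrightarrow> as = []" using x last_in_set[of as] by (cases "as = []") auto
      ultimately show ?thesis using 2 ux by auto
    next
      case 3
      have "w \<noteq> hd (bs @ x # as)" using 3 x dis by (cases bs) auto
      moreover have "adj G u w \<longleftrightarrow> w = last as" using 3 au adj_sym by metis
      ultimately show ?thesis using 3 by auto
    qed
  qed
  then show ?thesis using l x ip' dis by (auto simp: cyc_def)
qed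

lemma cyc_rev: "cyc G u ps \<Longrightarrow> cyc G u (rev ps)"
  by (auto simp: cyc_def ipath_rev hd_rev last_rev)

lemma hole_obtain_cyc:
  assumes "is_hole G H" "u \<in> H"
  obtains ps where "cyc G u ps" "H = insert u (set ps)"
proof -
  obtain xs where d: "distinct xs" and s: "set xs = H" and l: "4 \<le> length xs"
    and a: "\<And>i j. i < length xs \<Longrightarrow> j < length xs \<Longrightarrow> adj G (xs ! i) (xs ! j) \<longleftrightarrow>
              (j = Suc i mod length xs \<or> i = Suc j mod length xs)"
    using assms(1) unfolding is_hole_def by metis
  obtain x ps where xs: "xs = x # ps" using l by (cases xs) auto
  have c: "cyc G x ps"
    by (rule hole_Cons_cyc) (use d l a xs in auto)
  show thesis
  proof (cases "u = x")
    case True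
    then show thesis using that[of ps] c s xs by auto
  next
    case False
    then obtain as bs where ps: "ps = as @ u # bs" using assms(2) s xs
      by (metis set_ConsD split_list)
    show thesis using that[OF cyc_rotate[of G x as u bs]] c s xs ps by auto
  qed
qed

text \<open>Shortcut: the path is cut at the last vertex adjacent to \<open>x\<close>, which is then
  the only neighbour of \<open>x\<close> on the rest. If \<open>x\<close> is on the path, the path
  is cut at \<open>x\<close> itself.\<close>

lemma ipath_touch_extend:
  assumes ip: "ipath G qs" and t: "touch G x (set qs)"
  obtains qs' where "ipath G (x # qs')" "set qs' \<subseteq> set qs" "last (x # qs') = last qs"
proof (cases "x \<in> set qs")
  case True
  then obtain as bs where "qs = as @ x # bs" by (meson split_list)
  then show thesis using that[of bs] ip by (auto simp: ipath_append)
next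
  case False
  then have "\<exists>b\<in>set qs. adj G x b" using t by (auto simp: touch_def)
  then obtain as b cs where q: "qs = as @ b # cs" "adj G x b" "\<forall>c\<in>set cs. \<not> adj G x c"
    by (metis split_list_last_prop)
  have "ipath G (x # b # cs)" using q ip False by (auto simp: ipath_append)
  then show thesis using that[of "b # cs"] q by auto
qed

text \<open>The vertices of \<open>ps\<close> are put in front of \<open>qs\<close> one at a time,
  from the back, each with a shortcut by \<open>ipath_touch_extend\<close>.\<close>

lemma ipath_join:
  assumes "ipath G ps" "ipath G qs" "ps \<noteq> []" "qs \<noteq> []" "last ps = hd qs"
  shows "\<exists>rs. rs \<noteq> [] \<and> ipath G rs \<and> hd rs = hd ps \<and> last rs = last qs \<and> set rs \<subseteq> set ps \<union> set qs"
  using assms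
proof (induction ps)
  case (Cons x ps)
  show ?case
  proof (cases "ps = []")
    case True
    then show ?thesis using Cons.prems by (intro exI[of _ qs]) auto
  next
    case False
    then obtain rs where rs: "rs \<noteq> []" "ipath G rs" "hd rs = hd ps" "last rs = last qs"
      "set rs \<subseteq> set ps \<union> set qs" using Cons by auto
    have "adj G x (hd rs)" using Cons.prems(1) False rs by auto
    then have "touch G x (set rs)" using rs(1) by (auto simp: touch_def)
    then obtain qs' where "ipath G (x # qs')" "set qs' \<subseteq> set rs" "last (x # qs') = last rs"
      using ipath_touch_extend[OF rs(2)] by blast
    then show ?thesis using rs by (intro exI[of _ "x # qs'"]) auto
  qed
qed simp

text \<open>Take a stretch of the path that \<open>s\<close> touches and that ends in a vertex
  \<open>b\<close> equal or adjacent to \<open>t\<close>; shortcut it from \<open>s\<close>, then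
  shortcut the result from \<open>t\<close>. Non-adjacency of \<open>s\<close> and \<open>t\<close>
  makes the interior \<open>zs\<close> nonempty.\<close>

lemma ipath_link:
  assumes ip: "ipath G xs" and s: "touch G s (set xs)" and t: "touch G t (set xs)"
    and ne: "s \<noteq> t" and na: "\<not> adj G s t"
  obtains zs where "zs \<noteq> []" "set zs \<subseteq> set xs" "ipath G (s # zs @ [t])"
proof -
  obtain b where b: "b \<in> set xs" "t = b \<or> adj G t b" using t by (auto simp: touch_def)
  obtain cs ds where xs: "xs = cs @ b # ds" using b(1) by (meson split_list)
  \<comment> \<open>The stretch is the prefix up to \<open>b\<close> if \<open>s\<close> touches it,
    and otherwise the suffix from \<open>b\<close> read backwards.\<close>
  have "\<exists>qs. ipath G qs \<and> qs \<noteq> [] \<and> last qs = b \<and> set qs \<subseteq> set xs \<and> touch G s (set qs)"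
  proof (cases "touch G s (set (cs @ [b]))")
    case True
    then show ?thesis using ip xs by (intro exI[of _ "cs @ [b]"]) (auto simp: ipath_append)
  next
    case False
    then have "touch G s (set (rev (b # ds)))" using s xs by (auto simp: touch_def)
    moreover have "ipath G (rev (b # ds))" using ip xs unfolding ipath_rev by (auto simp: ipath_append)
    ultimately show ?thesis using xs by (intro exI[of _ "rev (b # ds)"]) auto
  qed
  then obtain qs where qs: "ipath G qs" "qs \<noteq> []" "last qs = b" "set qs \<subseteq> set xs" "touch G s (set qs)"
    by blast
  obtain q1 where q1: "ipath G (s # q1)" "set q1 \<subseteq> set qs" "last (s # q1) = b"
    using ipath_touch_extend[OF qs(1,5)] qs(3) by metis
  have "b \<in> set (s # q1)" using q1(3) by (metis last_in_set list.distinct(1))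
  then have "touch G t (set (rev (s # q1)))" using b(2) by (auto simp: touch_def)
  moreover have "ipath G (rev (s # q1))" using q1(1) by (simp only: ipath_rev)
  ultimately obtain q2 where q2: "ipath G (t # q2)" "set q2 \<subseteq> set (rev (s # q1))"
    "last (t # q2) = last (rev (s # q1))"
    using ipath_touch_extend by metis
  have "last (t # q2) = s" using q2(3) by simp
  then obtain z where z: "q2 = z @ [s]" using ne by (metis append_butlast_last_id last.simps)
  have ipz: "ipath G (s # rev z @ [t])"
    using q2(1) z ipath_rev[of G "t # z @ [s]"] by simp
  have "s \<notin> set z" using ipath_distinct[OF q2(1)] z by auto
  then have "set (rev z) \<subseteq> set xs" using q2(2) z q1(2) qs(4) by auto
  moreover have "rev z \<noteq> []" using ipz na by auto
  ultimately show thesis using that ipz by blast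
qed

section \<open>Local chordalization creates no hole\<close>

text \<open>By the NC property, the vertices touching \<open>xs\<close> are consecutive along the
  hole cut open at \<open>u\<close>. Otherwise a gap \<open>g\<close> between touching vertices
  \<open>s\<close> and \<open>t\<close>, closed by a link of \<open>s\<close> and \<open>t\<close>
  through \<open>xs\<close>, is a hole that avoids \<open>u\<close> but shares with the given one
  the stretch \<open>s, g, t\<close>, hence two consecutive edges.\<close>

lemma NC_vertex_contiguous:
  assumes wf: "wf_graph G" and nc: "NC_vertex G u" and c: "cyc G u (A @ w # B)"
    and ip: "ipath G xs" and u: "u \<notin> set xs"
    and tA: "\<exists>s\<in>set A. touch G s (set xs)" and tB: "\<exists>t\<in>set B. touch G t (set xs)"
  shows "touch G w (set xs)"
proof (rule ccontr)
  assume nw: "\<not> touch G w (set xs)"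
  obtain A1 s A2 where A: "A = A1 @ s # A2" "touch G s (set xs)" "\<forall>x\<in>set A2. \<not> touch G x (set xs)"
    using split_list_last_prop[OF tA] by metis
  obtain B1 t B2 where B: "B = B1 @ t # B2" "touch G t (set xs)" "\<forall>x\<in>set B1. \<not> touch G x (set xs)"
    using split_list_first_prop[OF tB] by metis
  define g where "g = A2 @ w # B1"
  have g: "g \<noteq> []" "\<forall>x\<in>set g. \<not> touch G x (set xs)" using A(3) B(3) nw by (auto simp: g_def)
  have ps: "A @ w # B = A1 @ (s # g @ [t]) @ B2" using A B by (simp add: g_def)
  have ipsgt: "ipath G (s # g @ [t])"
    using c unfolding cyc_def ps ipath_append by blast
  have st: "s \<noteq> t" "\<not> adj G s t"
    using ipsgt g(1) hd_in_set[OF g(1)] by (auto simp: ipath_append)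
  obtain z where z: "z \<noteq> []" "set z \<subseteq> set xs" "ipath G (s # z @ [t])"
    using ipath_link[OF ip A(2) B(2) st] by metis
  have gz: "\<forall>x\<in>set g. \<forall>y\<in>set z. x \<noteq> y \<and> \<not> adj G x y"
    using g(2) z(2) unfolding touch_def by blast
  have ipgt: "ipath G (g @ [t])" and ipz: "ipath G (rev z)" and ipzt: "ipath G (z @ [t])"
    using ipsgt z(3) by (auto simp: ipath_append ipath_rev)
  have tz: "t \<notin> set z" "\<forall>y\<in>set z. adj G t y \<longleftrightarrow> y = last z"
    using ipzt by (auto simp: ipath_append adj_sym)
  \<comment> \<open>The second hole, cut open at \<open>s\<close>: through the gap to
    \<open>t\<close>, then back along the link.\<close>
  have "ipath G ((g @ [t]) @ rev z)"
    unfolding ipath_append[of G "g @ [t]"]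
    using ipgt ipz gz tz ipgt[unfolded ipath_append] by (auto simp: hd_rev)
  moreover have "3 \<le> length ((g @ [t]) @ rev z)"
    using g(1) z(1) by (cases g; cases z) auto
  moreover have "s \<notin> set ((g @ [t]) @ rev z)" using ipsgt z(3) by auto
  moreover have "adj G s w \<longleftrightarrow> w = hd ((g @ [t]) @ rev z) \<or> w = last ((g @ [t]) @ rev z)"
    if "w \<in> set ((g @ [t]) @ rev z)" for w
  proof -
    have h: "hd ((g @ [t]) @ rev z) = hd g" "last ((g @ [t]) @ rev z) = hd z" "hd g \<in> set g" "hd z \<in> set z"
      using g(1) z(1) by (auto simp: last_rev)
    have a: "\<forall>y\<in>set (g @ [t]). adj G s y \<longleftrightarrow> y = hd g" "\<forall>y\<in>set (z @ [t]). adj G s y \<longleftrightarrow> y = hd z"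
      using ipsgt z(3) g(1) z(1) by auto
    show ?thesis unfolding h(1,2) using that a gz h(3,4) st(2) tz(1) by auto
  qed
  ultimately have c': "cyc G s ((g @ [t]) @ rev z)" unfolding cyc_def by blast
  have H': "is_hole G (insert s (set ((g @ [t]) @ rev z)))" by (rule cyc_is_hole[OF wf c'])
  have H: "is_hole G (insert u (set (A @ w # B)))" by (rule cyc_is_hole[OF wf c])
  \<comment> \<open>The first three vertices \<open>s, x, y\<close> of the shared stretch give the
    two consecutive edges; \<open>y\<close> is \<open>t\<close> if the gap is a single
    vertex.\<close>
  obtain x y r where xy: "g @ [t] = x # y # r"
    using g(1) by (cases g; cases "tl g") auto
  have adjs: "adj G s x" "adj G x y" "s \<noteq> y" using ipsgt unfolding xy by auto
  have mem: "x \<in> set (g @ [t])" "y \<in> set (g @ [t])" unfolding xy by auto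
  have "u \<notin> insert s (set ((g @ [t]) @ rev z))"
    using c u z(2) unfolding cyc_def ps by auto
  moreover have "{s, x} \<in> hole_edges G K \<and> {x, y} \<in> hole_edges G K"
    if "insert s (set (g @ [t])) \<subseteq> K" for K
    using adjs mem that by (auto simp: hole_edges_def adj_def)
  moreover have "insert s (set (g @ [t])) \<subseteq> insert u (set (A @ w # B))" unfolding ps by auto
  moreover have "insert s (set (g @ [t])) \<subseteq> insert s (set ((g @ [t]) @ rev z))" by auto
  ultimately have "is_hole G (insert u (set (A @ w # B))) \<and> u \<in> insert u (set (A @ w # B)) \<and>
      is_hole G (insert s (set ((g @ [t]) @ rev z))) \<and> u \<notin> insert s (set ((g @ [t]) @ rev z)) \<and> s \<noteq> y \<and>
      {s, x} \<in> hole_edges G (insert u (set (A @ w # B))) \<and>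
      {x, y} \<in> hole_edges G (insert u (set (A @ w # B))) \<and>
      {s, x} \<in> hole_edges G (insert s (set ((g @ [t]) @ rev z))) \<and>
      {x, y} \<in> hole_edges G (insert s (set ((g @ [t]) @ rev z)))"
    using H H' adjs(3) by (intro conjI insertI1) (rule, assumption | simp only:)+
  then show False using nc unfolding NC_vertex_def by (elim notE) (intro exI)
qed

text \<open>The inner vertices of an induced route from \<open>D\<close> to \<open>u\<close>, so
  that two arcs and a path through \<open>D\<close> can close up to a cycle through
  \<open>u\<close>. A single vertex adjacent to both is the degenerate case.\<close>

definition uarc :: "'a graph \<Rightarrow> 'a \<Rightarrow> 'a set \<Rightarrow> 'a list \<Rightarrow> bool" where
  "uarc G u D X \<longleftrightarrow> X \<noteq> [] \<and> ipath G X \<and> u \<notin> set X \<and> set X \<inter> D = {} \<and>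
     (\<exists>d\<in>D. adj G (hd X) d) \<and> (\<forall>x\<in>set (tl X). \<forall>d\<in>D. \<not> adj G x d) \<and>
     (\<forall>x\<in>set X. adj G u x \<longleftrightarrow> x = last X)"

text \<open>Says in terms of \<open>G\<close> that \<open>D\<close> misses \<open>u\<close> and all
  neighbours of \<open>u\<close> in \<open>local_chordalize G u\<close>.\<close>

definition far :: "'a graph \<Rightarrow> 'a \<Rightarrow> 'a set \<Rightarrow> bool" where
  "far G u D \<longleftrightarrow> (\<forall>d\<in>D. d \<noteq> u \<and> \<not> adj G u d \<and> (\<forall>H. is_hole G H \<longrightarrow> u \<in> H \<longrightarrow> d \<notin> H))"

text \<open>If the arcs did not touch, a link of their heads through \<open>ds\<close> would close
  with \<open>u\<close> to a hole that contains a vertex of \<open>ds\<close>, contrary to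
  \<open>far\<close>.\<close>

lemma uarcs_touch:
  assumes wf: "wf_graph G" and ip: "ipath G ds" and far: "far G u (set ds)"
    and X: "uarc G u (set ds) X" and Y: "uarc G u (set ds) Y"
  shows "\<exists>x\<in>set X. touch G x (set Y)"
proof (rule ccontr)
  assume "\<not> ?thesis"
  then have n: "\<forall>x\<in>set X. \<forall>y\<in>set Y. x \<noteq> y \<and> \<not> adj G x y" by (auto simp: touch_def)
  have x: "hd X \<in> set X" "hd Y \<in> set Y" "last X \<in> set X" "last Y \<in> set Y"
    using X Y by (auto simp: uarc_def)
  have "touch G (hd X) (set ds)" "touch G (hd Y) (set ds)" "hd X \<noteq> hd Y" "\<not> adj G (hd X) (hd Y)"
    using X Y n x by (auto simp: uarc_def touch_def)
  then obtain z where z: "z \<noteq> []" "set z \<subseteq> set ds" "ipath G (hd X # z @ [hd Y])"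
    using ipath_link[OF ip] by metis
  have ipz: "ipath G z" using z(3) by (auto simp: ipath_append)
  have ax: "\<forall>d\<in>set z. adj G (hd X) d \<longleftrightarrow> d = hd z" using z(1,3) by auto
  have ay: "\<forall>d\<in>set z. adj G d (hd Y) \<longleftrightarrow> d = last z" using z(1,3) by (auto simp: ipath_append)
  have tX: "x = hd X" if "x \<in> set X" "d \<in> set z" "adj G x d" for x d
    using X that z(2) unfolding uarc_def by (cases X) auto
  have tY: "x = hd Y" if "x \<in> set Y" "d \<in> set z" "adj G d x" for x d
    using Y that z(2) adj_sym[of G d x] unfolding uarc_def by (cases Y) auto
  have dj: "set X \<inter> set z = {}" "set Y \<inter> set z = {}" using X Y z(2) unfolding uarc_def by blast+
  have "ipath G (z @ Y)"
    unfolding ipath_append using ipz Y ay tY dj z(1) x unfolding uarc_def by blast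
  moreover have "adj G x y \<longleftrightarrow> x = last (rev X) \<and> y = hd (z @ Y)" if "x \<in> set (rev X)" "y \<in> set (z @ Y)" for x y
  proof -
    have h: "last (rev X) = hd X" "hd (z @ Y) = hd z" using z(1) X by (auto simp: uarc_def last_rev)
    show ?thesis
    proof (cases "y \<in> set z")
      case True
      then show ?thesis unfolding h using tX ax that(1) by auto
    next
      case False
      then have "y \<in> set Y" using that(2) by auto
      moreover have "y \<noteq> hd z" using False hd_in_set[OF z(1)] by auto
      ultimately show ?thesis unfolding h using n that(1) by auto
    qed
  qed
  moreover have "set (rev X) \<inter> set (z @ Y) = {}" using dj n by auto
  moreover have "ipath G (rev X)" using X by (simp add: uarc_def ipath_rev)
  ultimately have "ipath G (rev X @ z @ Y)"
    unfolding ipath_append[of G "rev X"] by blast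
  moreover have "3 \<le> length (rev X @ z @ Y)"
    using X Y z(1) unfolding uarc_def by (cases X; cases z; cases Y) auto
  moreover have nu: "u \<notin> set (rev X @ z @ Y)"
    using X Y z(2) far unfolding uarc_def far_def by auto
  moreover have "adj G u w \<longleftrightarrow> w = hd (rev X @ z @ Y) \<or> w = last (rev X @ z @ Y)"
    if "w \<in> set (rev X @ z @ Y)" for w
  proof -
    have h: "hd (rev X @ z @ Y) = last X" "last (rev X @ z @ Y) = last Y"
      using X Y unfolding uarc_def by (auto simp: hd_rev)
    have "\<forall>d\<in>set z. \<not> adj G u d" using far z(2) unfolding far_def by blast
    moreover have "\<forall>x\<in>set X. adj G u x \<longleftrightarrow> x = last X" "\<forall>x\<in>set Y. adj G u x \<longleftrightarrow> x = last Y"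
      using X Y unfolding uarc_def by blast+
    ultimately show ?thesis unfolding h using that n dj x by auto
  qed
  ultimately have "cyc G u (rev X @ z @ Y)" unfolding cyc_def by blast
  from cyc_is_hole[OF wf this] have "is_hole G (insert u (set (rev X @ z @ Y)))" .
  moreover have "hd z \<in> insert u (set (rev X @ z @ Y))" using z(1) by simp
  moreover have "hd z \<in> set ds" using z(1,2) by auto
  ultimately show False using far unfolding far_def by blast
qed

text \<open>Walk along the hole from \<open>w\<close> through \<open>B\<close> to the last vertex
  with a neighbour in \<open>D\<close>; the rest from there on is an arc. Since \<open>w\<close> is
  no neighbour of \<open>u\<close>, the first end of the opened hole lies before \<open>w\<close>,
  and only the other end is adjacent to \<open>u\<close>.\<close>

lemma far_uarc_right:
  assumes wf: "wf_graph G" and c: "cyc G u (A @ w # B)"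
    and far: "far G u D" and nb: "\<exists>d\<in>D. adj G w d" and nu: "\<not> adj G u w"
  shows "\<exists>X. uarc G u D X \<and> set X \<subseteq> set (w # B)"
proof -
  have H: "is_hole G (insert u (set (A @ w # B)))" by (rule cyc_is_hole[OF wf c])
  have "\<exists>x\<in>set (w # B). \<exists>d\<in>D. adj G x d" using nb by simp
  then obtain B1 x B2 where B: "w # B = B1 @ x # B2" "\<exists>d\<in>D. adj G x d" "\<forall>y\<in>set B2. \<not> (\<exists>d\<in>D. adj G y d)"
    using split_list_last_prop[of "w # B" "\<lambda>x. \<exists>d\<in>D. adj G x d"] by metis
  have ps: "A @ w # B = (A @ B1) @ x # B2" using B by simp
  have "set (x # B2) \<inter> D = {}" using far H ps unfolding far_def by auto
  moreover have "adj G u y \<longleftrightarrow> y = last (x # B2)" if y: "y \<in> set (x # B2)" for y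
  proof -
    have "y \<noteq> hd (A @ w # B)"
    proof
      assume e: "y = hd (A @ w # B)"
      have d: "distinct (A @ w # B)" using c ipath_distinct unfolding cyc_def by blast
      have "hd (A @ w # B) \<in> set (A @ w # B)" by (rule hd_in_set) simp
      then have "adj G u (hd (A @ w # B))" using c unfolding cyc_def by blast
      then have "A \<noteq> []" using nu by auto
      then have "y \<in> set A" using e by auto
      then show False using d y unfolding ps by auto
    qed
    moreover have "last (A @ w # B) = last (x # B2)" unfolding ps by simp
    moreover have "y \<in> set (A @ w # B)" using y unfolding ps by auto
    ultimately show ?thesis using c unfolding cyc_def by metis
  qed
  moreover have "ipath G (x # B2)" "u \<notin> set (x # B2)"
    using c unfolding cyc_def ps ipath_append by auto
  ultimately have "uarc G u D (x # B2)" using B(2,3) unfolding uarc_def by auto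
  moreover have "set (x # B2) \<subseteq> set (w # B)" unfolding B(1) by auto
  ultimately show ?thesis by blast
qed

text \<open>If \<open>w\<close> is a neighbour of \<open>u\<close>, then \<open>[w]\<close> is
  itself an arc. Otherwise \<open>w\<close> lies on a hole through \<open>u\<close>,
  \<open>far_uarc_right\<close> yields an arc on each side of \<open>w\<close>, both touch
  \<open>xs\<close>, and \<open>NC_vertex_contiguous\<close> carries this over to
  \<open>w\<close>.\<close>

lemma touch_attachment:
  assumes wf: "wf_graph G" and nc: "NC_vertex G u" and far: "far G u D"
    and w: "adj G u w \<or> (\<exists>H. is_hole G H \<and> u \<in> H \<and> w \<in> H)" and wu: "w \<noteq> u"
    and nb: "\<exists>d\<in>D. adj G w d"
    and ip: "ipath G xs" and u: "u \<notin> set xs"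
    and all: "\<And>X. uarc G u D X \<Longrightarrow> \<exists>x\<in>set X. touch G x (set xs)"
  shows "touch G w (set xs)"
proof (cases "adj G u w")
  case True
  then have "uarc G u D [w]" using nb far wu unfolding uarc_def far_def by auto
  from all[OF this] show ?thesis by simp
next
  case False
  then obtain H where H: "is_hole G H" "u \<in> H" "w \<in> H" using w by blast
  obtain ps where ps: "cyc G u ps" "H = insert u (set ps)" using hole_obtain_cyc[OF H(1,2)] by metis
  obtain A B where AB: "ps = A @ w # B" using ps(2) H(3) wu by (metis insertE split_list)
  have c: "cyc G u (A @ w # B)" using ps AB by simp
  have c': "cyc G u (rev B @ w # rev A)" using cyc_rev[OF c] by simp
  obtain X where X: "uarc G u D X" "set X \<subseteq> set (w # B)"
    using far_uarc_right[OF wf c far nb False] by blast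
  obtain Y where Y: "uarc G u D Y" "set Y \<subseteq> set (w # rev A)"
    using far_uarc_right[OF wf c' far nb False] by blast
  have tB: "\<exists>t\<in>set (w # B). touch G t (set xs)" using all[OF X(1)] X(2) by blast
  have tA: "\<exists>s\<in>set (w # A). touch G s (set xs)" using all[OF Y(1)] Y(2) by auto
  show ?thesis
    using NC_vertex_contiguous[OF wf nc c ip u] tA tB by auto
qed

text \<open>Every arc touches every other arc, hence \<open>y\<close>; then \<open>{y}\<close> touches every arc, hence \<open>z\<close>.\<close>

lemma far_attachments_clique:
  assumes wf: "wf_graph G" and nc: "NC_vertex G u" and ip: "ipath G ds" and far: "far G u (set ds)"
    and y: "adj G u y \<or> (\<exists>H. is_hole G H \<and> u \<in> H \<and> y \<in> H)" "y \<noteq> u" "\<exists>d\<in>set ds. adj G y d"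
    and z: "adj G u z \<or> (\<exists>H. is_hole G H \<and> u \<in> H \<and> z \<in> H)" "z \<noteq> u" "\<exists>d\<in>set ds. adj G z d"
  shows "z = y \<or> adj G z y"
proof -
  have "touch G y (set X)" if X: "uarc G u (set ds) X" for X
    using touch_attachment[OF wf nc far y, of X] X uarcs_touch[OF wf ip far _ X]
    unfolding uarc_def by blast
  then have "\<exists>x\<in>set X. touch G x (set [y])" if "uarc G u (set ds) X" for X
    using that adj_sym unfolding touch_def by fastforce
  then have "touch G z (set [y])"
    using touch_attachment[OF wf nc far z, of "[y]"] y(2) by auto
  then show ?thesis by (simp add: touch_def)
qed

section \<open>Local chordalization: adjacency, surviving holes and the NC property\<close>

lemma local_chordalize_simps [simp]:
  "verts (local_chordalize G u) = verts G"
  "edges (local_chordalize G u) =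
     edges G \<union> {{u, w} | w. w \<noteq> u \<and> (\<exists>H. is_hole G H \<and> u \<in> H \<and> w \<in> H)}"
  by (auto simp: local_chordalize_def verts_def edges_def)

lemma adj_local_chordalize_other:
  "x \<noteq> u \<Longrightarrow> y \<noteq> u \<Longrightarrow> adj (local_chordalize G u) x y \<longleftrightarrow> adj G x y"
  by (auto simp: adj_def doubleton_eq_iff)

lemma adj_local_chordalize_center:
  "adj (local_chordalize G u) u w \<longleftrightarrow>
     w \<noteq> u \<and> (adj G u w \<or> (\<exists>H. is_hole G H \<and> u \<in> H \<and> w \<in> H))"
  by (auto simp: adj_def doubleton_eq_iff)

lemma ipath_cong:
  assumes "\<And>x y. x \<in> set xs \<Longrightarrow> y \<in> set xs \<Longrightarrow> adj G x y \<longleftrightarrow> adj G' x y"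
  shows "ipath G xs \<longleftrightarrow> ipath G' xs"
  using assms by (induction xs) auto

lemma hole_cong:
  assumes "H \<subseteq> verts G \<longleftrightarrow> H \<subseteq> verts G'" "\<And>x y. x \<in> H \<Longrightarrow> y \<in> H \<Longrightarrow> adj G x y \<longleftrightarrow> adj G' x y"
  shows "is_hole G H \<longleftrightarrow> is_hole G' H"
proof -
  have "adj G (xs ! i) (xs ! j) \<longleftrightarrow> adj G' (xs ! i) (xs ! j)"
    if "set xs = H" "i < length xs" "j < length xs" for xs i j
    using assms(2) that by auto
  then show ?thesis unfolding is_hole_def using assms(1) by (simp cong: conj_cong)
qed

text \<open>Holes avoiding \<open>u\<close> do not feel the new edges, which all end in
  \<open>u\<close>. A hole through \<open>u\<close> in the new graph, cut open at \<open>u\<close>,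
  has an inner stretch \<open>ds\<close> far from \<open>u\<close>; its outer neighbours
  \<open>y\<close> and \<open>z\<close> both attach to \<open>ds\<close>, so
  \<open>far_attachments_clique\<close> makes \<open>yz\<close> a chord.\<close>

lemma local_chordalize_hole:
  assumes wf: "wf_graph G" and nc: "NC_vertex G u" and H: "is_hole (local_chordalize G u) H"
  shows "is_hole G H \<and> u \<notin> H"
proof (cases "u \<in> H")
  case False
  then have "is_hole G H \<longleftrightarrow> is_hole (local_chordalize G u) H"
    by (intro hole_cong) (auto intro!: adj_local_chordalize_other[symmetric])
  then show ?thesis using H False by simp
next
  case True
  let ?G = "local_chordalize G u"
  obtain ps where c: "cyc ?G u ps" "H = insert u (set ps)" using hole_obtain_cyc[OF H True] by metis
  have l: "3 \<le> length ps" and nu: "u \<notin> set ps" and ip0: "ipath ?G ps"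
    and au: "\<forall>w\<in>set ps. adj ?G u w \<longleftrightarrow> w = hd ps \<or> w = last ps"
    using c(1) unfolding cyc_def by blast+
  have ip: "ipath G ps"
    using ip0 ipath_cong[of ps G ?G] adj_local_chordalize_other[of _ u _ G] nu by metis
  obtain y qs where y: "ps = y # qs" using l by (cases ps) auto
  have "qs \<noteq> []" using l y by auto
  then obtain ds z where z: "qs = ds @ [z]" by (metis append_butlast_last_id)
  have ps: "ps = y # ds @ [z]" using y z by simp
  have ds: "ds \<noteq> []" using l ps by auto
  have ipd: "ipath G ds" using ip unfolding ps by (auto simp: ipath_append)
  have d: "distinct ps" using ip by (rule ipath_distinct)
  have far: "far G u (set ds)"
    unfolding far_def
  proof
    fix x assume x: "x \<in> set ds"
    have "x \<noteq> hd ps" "x \<noteq> last ps" "x \<in> set ps" using x d unfolding ps by auto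
    then have "\<not> adj ?G u x" "x \<noteq> u" using au nu by auto
    then show "x \<noteq> u \<and> \<not> adj G u x \<and> (\<forall>H. is_hole G H \<longrightarrow> u \<in> H \<longrightarrow> x \<notin> H)"
      unfolding adj_local_chordalize_center by blast
  qed
  have "adj ?G u y" "adj ?G u z" using au unfolding ps by auto
  then have uy: "adj G u y \<or> (\<exists>H. is_hole G H \<and> u \<in> H \<and> y \<in> H)" "y \<noteq> u"
    and uz: "adj G u z \<or> (\<exists>H. is_hole G H \<and> u \<in> H \<and> z \<in> H)" "z \<noteq> u"
    unfolding adj_local_chordalize_center by blast+
  have "adj G y (hd ds)" "adj G (last ds) z" using ip ds unfolding ps by (auto simp: ipath_append)
  then have "\<exists>d\<in>set ds. adj G y d" "\<exists>d\<in>set ds. adj G z d"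
    using ds adj_sym hd_in_set[OF ds] last_in_set[OF ds] by metis+
  then have "z = y \<or> adj G z y"
    using far_attachments_clique[OF wf nc ipd far uy _ uz] by blast
  moreover have "z \<noteq> y" using d unfolding ps by auto
  moreover have "\<not> adj G y z" using ip ds \<open>z \<noteq> y\<close> d unfolding ps by auto
  ultimately show ?thesis using adj_sym by metis
qed

lemma hole_verts: "is_hole G H \<Longrightarrow> H \<subseteq> verts G"
  by (simp add: is_hole_def)

lemma wf_local_chordalize:
  assumes "wf_graph G" shows "wf_graph (local_chordalize G u)"
proof -
  have "\<exists>a b. a \<noteq> b \<and> {u, w} = {a, b} \<and> a \<in> verts G \<and> b \<in> verts G"
    if "w \<noteq> u" "is_hole G H" "u \<in> H" "w \<in> H" for w H
    using that hole_verts[OF that(2)] by (intro exI[of _ u] exI[of _ w]) auto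
  then show ?thesis using assms unfolding wf_graph_def by auto
qed

lemma hole_edges_local_chordalize:
  "u \<notin> H \<Longrightarrow> hole_edges (local_chordalize G u) H = hole_edges G H"
  by (auto simp: hole_edges_def)

text \<open>The holes of the new graph are old holes avoiding \<open>u\<close>, with the same edges,
  so a violation of the NC property there would be one in \<open>G\<close>.\<close>

lemma NC_set_local_chordalize:
  assumes wf: "wf_graph G" and nc: "NC_set G C" and u: "u \<in> C"
  shows "NC_set (local_chordalize G u) C"
proof -
  have h: "is_hole G H \<and> u \<notin> H" if "is_hole (local_chordalize G u) H" for H
    using local_chordalize_hole[OF wf _ that] nc u unfolding NC_set_def by blast
  have "NC_vertex (local_chordalize G u) v" if "v \<in> C" for v
  proof -
    have v: "NC_vertex G v" using nc that unfolding NC_set_def by blast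
    show ?thesis
      unfolding NC_vertex_def
    proof (intro notI, elim exE conjE)
      fix H H' x y z
      assume a: "is_hole (local_chordalize G u) H" "v \<in> H" "is_hole (local_chordalize G u) H'" "v \<notin> H'" "x \<noteq> z"
        "{x, y} \<in> hole_edges (local_chordalize G u) H" "{y, z} \<in> hole_edges (local_chordalize G u) H"
        "{x, y} \<in> hole_edges (local_chordalize G u) H'" "{y, z} \<in> hole_edges (local_chordalize G u) H'"
      have "is_hole G H" "is_hole G H'" "u \<notin> H" "u \<notin> H'" using h a by blast+
      then show False using v a hole_edges_local_chordalize unfolding NC_vertex_def by metis
    qed
  qed
  then show ?thesis using nc h unfolding NC_set_def by blast
qed

text \<open>No step creates a hole, so the hole responsible for an edge added later is already a
  hole of the initial graph; the NC property persists for all of \<open>C\<close>.\<close>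

lemma foldl_local_chordalize:
  assumes "wf_graph G" "NC_set G C" "set xs \<subseteq> C"
  shows "verts (foldl local_chordalize G xs) = verts G \<and> wf_graph (foldl local_chordalize G xs) \<and>
    edges G \<subseteq> edges (foldl local_chordalize G xs) \<and>
    (\<forall>e\<in>edges (foldl local_chordalize G xs) - edges G.
       \<exists>u w H. e = {u, w} \<and> u \<in> C \<and> w \<noteq> u \<and> is_hole G H \<and> u \<in> H \<and> w \<in> H)"
  using assms
proof (induction xs arbitrary: G)
  case (Cons u xs)
  let ?G = "local_chordalize G u"
  have u: "u \<in> C" using Cons.prems by simp
  have nc: "NC_vertex G u" using Cons.prems u unfolding NC_set_def by blast
  have IH: "verts (foldl local_chordalize ?G xs) = verts ?G \<and> wf_graph (foldl local_chordalize ?G xs) \<and>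
    edges ?G \<subseteq> edges (foldl local_chordalize ?G xs) \<and>
    (\<forall>e\<in>edges (foldl local_chordalize ?G xs) - edges ?G.
       \<exists>u w H. e = {u, w} \<and> u \<in> C \<and> w \<noteq> u \<and> is_hole ?G H \<and> u \<in> H \<and> w \<in> H)"
    using Cons.IH[of ?G] wf_local_chordalize[OF Cons.prems(1)]
      NC_set_local_chordalize[OF Cons.prems(1,2) u] Cons.prems(3) by simp
  have "\<exists>u w H. e = {u, w} \<and> u \<in> C \<and> w \<noteq> u \<and> is_hole G H \<and> u \<in> H \<and> w \<in> H"
    if e: "e \<in> edges (foldl local_chordalize ?G xs)" "e \<notin> edges G" for e
  proof (cases "e \<in> edges ?G")
    case True
    then show ?thesis using e(2) u by auto
  next
    case False
    then obtain v w H where "e = {v, w}" "v \<in> C" "w \<noteq> v" "is_hole ?G H" "v \<in> H" "w \<in> H"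
      using IH e(1) by (meson DiffI)
    moreover from this have "is_hole G H" using local_chordalize_hole[OF Cons.prems(1) nc] by blast
    ultimately show ?thesis by (intro exI[of _ v] exI[of _ w] exI[of _ H]) simp
  qed
  then show ?case using IH by auto
qed auto

lemma hat_props:
  assumes wf: "wf_graph G" and C: "C \<subseteq> verts G" and nc: "NC_set G C"
  shows "verts (hat G C) = verts G" "wf_graph (hat G C)" "edges G \<subseteq> edges (hat G C)"
    and "\<And>e. e \<in> edges (hat G C) \<Longrightarrow> e \<notin> edges G \<Longrightarrow>
       \<exists>u w H. e = {u, w} \<and> u \<in> C \<and> w \<noteq> u \<and> is_hole G H \<and> u \<in> H \<and> w \<in> H"
proof -
  \<comment> \<open>Finiteness provides an enumeration of \<open>C\<close>, so the choice made in
    \<open>hat\<close> really is one.\<close>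
  have "finite C" using wf C unfolding wf_graph_def by (metis finite_subset)
  then have "\<exists>xs. distinct xs \<and> set xs = C" using finite_distinct_list by metis
  then have "set (SOME xs. distinct xs \<and> set xs = C) = C" by (metis (mono_tags, lifting) someI_ex)
  then have s: "set (SOME xs. distinct xs \<and> set xs = C) \<subseteq> C" by simp
  note F = foldl_local_chordalize[OF wf nc s, folded hat_def]
  show "verts (hat G C) = verts G" "wf_graph (hat G C)" "edges G \<subseteq> edges (hat G C)"
    using F by blast+
  show "\<And>e. e \<in> edges (hat G C) \<Longrightarrow> e \<notin> edges G \<Longrightarrow>
       \<exists>u w H. e = {u, w} \<and> u \<in> C \<and> w \<noteq> u \<and> is_hole G H \<and> u \<in> H \<and> w \<in> H"
    using F by blast
qed

section \<open>Cliques and holes after local chordalization\<close>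

text \<open>As \<open>w\<close> is not adjacent to \<open>u\<close>, both sides of the opened hole
  are nonempty and its second end lies in \<open>B\<close>; only the first end remains in
  \<open>A @ [w]\<close>.\<close>

lemma cyc_left_side:
  assumes c: "cyc G u (A @ w # B)" and nu: "\<not> adj G u w"
  shows "A \<noteq> [] \<and> ipath G (A @ [w]) \<and> u \<notin> set (A @ [w]) \<and> (\<forall>a\<in>set (A @ [w]). adj G u a \<longleftrightarrow> a = hd A)"
proof -
  let ?p = "A @ w # B"
  have ip: "ipath G ?p" and u: "u \<notin> set ?p" and au: "\<forall>a\<in>set ?p. adj G u a \<longleftrightarrow> a = hd ?p \<or> a = last ?p"
    using c unfolding cyc_def by blast+
  have d: "distinct ?p" using ip by (rule ipath_distinct)
  have "w \<noteq> hd ?p" "w \<noteq> last ?p" using au nu by (metis in_set_conv_decomp)+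
  then have A: "A \<noteq> []" and B: "B \<noteq> []" by auto
  have "hd ?p = hd A" "last ?p = last B" "last B \<in> set B" using A B by auto
  then have "\<forall>a\<in>set (A @ [w]). adj G u a \<longleftrightarrow> a = hd A" using au d by auto
  moreover have "ipath G (A @ [w])" using ip ipath_append[of G "A @ [w]" B] by simp
  ultimately show ?thesis using A u by auto
qed

text \<open>The one-vertex path \<open>[v]\<close> does not touch \<open>w\<close>, so by
  \<open>NC_vertex_contiguous\<close> it is touched from at most one of the two sides of the hole;
  \<open>L\<close> is the other side, listed from \<open>u\<close> towards \<open>w\<close>.\<close>

lemma NC_hole_side_avoiding:
  assumes wf: "wf_graph G" and nc: "NC_vertex G u" and H: "is_hole G H" "u \<in> H" "w \<in> H"
    and uw: "\<not> adj G u w" "w \<noteq> u" and uv: "u \<noteq> v" and vw: "v \<noteq> w" "\<not> adj G v w"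
  obtains L where "L \<noteq> []" "ipath G (L @ [w])" "u \<notin> set (L @ [w])"
    "\<forall>a\<in>set (L @ [w]). adj G u a \<longleftrightarrow> a = hd L" "\<forall>a\<in>set L. a \<noteq> v \<and> \<not> adj G v a"
proof -
  obtain ps where ps: "cyc G u ps" "H = insert u (set ps)" using hole_obtain_cyc[OF H(1,2)] by metis
  obtain A B where AB: "ps = A @ w # B" using ps(2) H(3) uw(2) by (metis insertE split_list)
  have c: "cyc G u (A @ w # B)" using ps AB by simp
  have c': "cyc G u (rev B @ w # rev A)" using cyc_rev[OF c] by simp
  have t: "touch G a (set [v]) \<longleftrightarrow> a = v \<or> adj G v a" for a
    using adj_sym[of G a v] by (auto simp: touch_def)
  have "(\<forall>a\<in>set A. \<not> touch G a (set [v])) \<or> (\<forall>a\<in>set B. \<not> touch G a (set [v]))"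
    using NC_vertex_contiguous[OF wf nc c, of "[v]"] t vw uv by auto
  then show thesis
  proof
    assume "\<forall>a\<in>set A. \<not> touch G a (set [v])"
    then show thesis using that[of A] cyc_left_side[OF c uw(1)] t by auto
  next
    assume "\<forall>a\<in>set B. \<not> touch G a (set [v])"
    then show thesis using that[of "rev B"] cyc_left_side[OF c' uw(1)] t by auto
  qed
qed

text \<open>From each hole take a side ending in \<open>w\<close> that the other centre does not
  touch. Joined at \<open>w\<close>, the sides contain an induced path from a neighbour of
  \<open>u\<close> to a neighbour of \<open>v\<close>, which the edge \<open>uv\<close> closes to a
  hole.\<close>

lemma adjacent_centers_common_hole:
  assumes wf: "wf_graph G" and nu: "NC_vertex G u" and nv: "NC_vertex G v" and uv: "adj G u v"
    and H: "is_hole G H" "u \<in> H" "w \<in> H" and H': "is_hole G H'" "v \<in> H'" "w \<in> H'"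
    and uw: "w \<noteq> u" "\<not> adj G u w" and vw: "w \<noteq> v" "\<not> adj G v w"
  shows "\<exists>K. is_hole G K \<and> u \<in> K \<and> v \<in> K"
proof -
  have ne: "u \<noteq> v" using uv by auto
  obtain L where L: "L \<noteq> []" "ipath G (L @ [w])" "u \<notin> set (L @ [w])"
    "\<forall>a\<in>set (L @ [w]). adj G u a \<longleftrightarrow> a = hd L" "\<forall>a\<in>set L. a \<noteq> v \<and> \<not> adj G v a"
    using NC_hole_side_avoiding[OF wf nu H uw(2,1) ne _ vw(2)] vw(1) by metis
  obtain M where M: "M \<noteq> []" "ipath G (M @ [w])" "v \<notin> set (M @ [w])"
    "\<forall>a\<in>set (M @ [w]). adj G v a \<longleftrightarrow> a = hd M" "\<forall>a\<in>set M. a \<noteq> u \<and> \<not> adj G u a"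
    using NC_hole_side_avoiding[OF wf nv H' vw(2,1) ne[symmetric] _ uw(2)] uw(1) by metis
  have "ipath G (rev (M @ [w]))" using M(2) by (simp only: ipath_rev)
  then obtain rs where rs: "rs \<noteq> []" "ipath G rs" "hd rs = hd L" "last rs = hd M"
    "set rs \<subseteq> set L \<union> {w} \<union> set M"
    using ipath_join[OF L(2), of "rev (M @ [w])"] L(1) M(1) by (auto simp: last_rev)
  have hL: "hd L \<in> set L" "hd M \<in> set M" using L(1) M(1) by auto
  have au: "adj G u r \<longleftrightarrow> r = hd rs" if "r \<in> set rs" for r
    using that rs(3,5) L(4) M(5) hL uw(2) by auto
  have av: "adj G v r \<longleftrightarrow> r = last rs" if "r \<in> set rs" for r
    using that rs(4,5) M(4) L(5) hL vw(2) by auto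
  have "u \<notin> set rs" "v \<notin> set rs" using rs(5) L(3,5) M(3,5) by auto
  \<comment> \<open>Two vertices of \<open>rs\<close> suffice for a hole together with
    \<open>u\<close> and \<open>v\<close>; they differ since \<open>hd M\<close> is adjacent to
    \<open>v\<close> and \<open>hd L\<close> is not.\<close>
  have "hd rs \<noteq> last rs" using rs(3,4) L(5) M(4) hL by auto
  then have "2 \<le> length rs" using rs(1) by (cases rs; cases "tl rs") auto
  moreover have "adj G v u" using uv adj_sym by metis
  ultimately have "cyc G v (u # rs)"
    unfolding cyc_def using rs(1,2) au av ne \<open>u \<notin> set rs\<close> \<open>v \<notin> set rs\<close> by auto
  from cyc_is_hole[OF wf this] show ?thesis by (intro exI[of _ "insert v (set (u # rs))"]) auto
qed

lemma square_hole:
  assumes wf: "wf_graph G" and "adj G a b" "adj G b c" "adj G c d" "adj G d a" "\<not> adj G a c" "\<not> adj G b d"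
    and "a \<noteq> c" "b \<noteq> d"
  shows "is_hole G {a, b, c, d}"
proof -
  have "adj G a d" using assms(5) adj_sym by metis
  then have "cyc G a [b, c, d]"
    using assms unfolding cyc_def by auto
  from cyc_is_hole[OF wf this] show ?thesis by simp
qed

text \<open>Every new edge has an end in \<open>C\<close>. If distinct \<open>u\<close> and
  \<open>v\<close> in \<open>C\<close> had non-neighbours \<open>w\<close> and \<open>x\<close> of
  \<open>G\<close> in \<open>K\<close>, these four vertices would form an induced square, a hole
  with two vertices of \<open>C\<close>. So all new edges inside \<open>K\<close> meet in one
  vertex, which is removed.\<close>

lemma hat_clique:
  assumes wf: "wf_graph G" and C: "C \<subseteq> verts G" and nc: "NC_set G C" and K: "is_clique (hat G C) K"
  shows "\<exists>u. is_clique G (K - {u})"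
proof -
  note hp = hat_props[OF wf C nc]
  have fin: "finite (H \<inter> C)" for H
    using wf C unfolding wf_graph_def by (meson finite_Int finite_subset)
  have one: "a = b" if "is_hole G H" "a \<in> H" "b \<in> H" "a \<in> C" "b \<in> C" for H a b
  proof -
    have "card (H \<inter> C) \<le> Suc 0" using nc that(1) unfolding NC_set_def by simp
    then show ?thesis using that fin[of H] by (simp add: card_le_Suc0_iff_eq)
  qed
  have new: "\<exists>H. is_hole G H \<and> x \<in> H \<and> y \<in> H \<and> (x \<in> C \<or> y \<in> C)"
    if "x \<in> K" "y \<in> K" "x \<noteq> y" "\<not> adj G x y" for x y
  proof -
    have "{x, y} \<in> edges (hat G C)" "{x, y} \<notin> edges G"
      using K that unfolding is_clique_def adj_def by blast+
    then obtain u w H where h: "{x, y} = {u, w}" "u \<in> C" "is_hole G H" "u \<in> H" "w \<in> H"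
      using hp(4) by metis
    then show ?thesis by (intro exI[of _ H]) (auto simp: doubleton_eq_iff)
  qed
  have KV: "K \<subseteq> verts G" using K hp(1) unfolding is_clique_def by simp
  have key: False
    if u: "u \<in> K" "u \<in> C" "w \<in> K" "w \<noteq> u" "\<not> adj G u w"
      and v: "v \<in> K" "v \<in> C" "x \<in> K" "x \<noteq> v" "\<not> adj G v x" and uv: "u \<noteq> v" for u v w x
  proof -
    have nu: "NC_vertex G u" and nv: "NC_vertex G v" using nc u v unfolding NC_set_def by blast+
    \<comment> \<open>A new edge comes from a hole containing both its ends, and no hole contains
      two vertices of \<open>C\<close>: so \<open>uv\<close> is an old edge, and by the same reason
      \<open>w\<close> and \<open>x\<close> are outside \<open>C\<close>.\<close>
    have auv: "adj G u v" using new[of u v] one uv u v by metis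
    have nC: "y \<notin> C" if "y \<in> K" "y \<noteq> a" "a \<in> K" "a \<in> C" "\<not> adj G a y" for a y
      using new[of a y] one that by metis
    have wx: "w \<notin> C" "x \<notin> C" using nC u v by blast+
    have common: False if y: "y \<in> K" "y \<notin> C" "\<not> adj G u y" "\<not> adj G v y" for y
    proof -
      have ne: "y \<noteq> u" "y \<noteq> v" using y(2) u v by auto
      obtain H where H: "is_hole G H" "u \<in> H" "y \<in> H" using new[of u y] y u ne by metis
      obtain H' where H': "is_hole G H'" "v \<in> H'" "y \<in> H'" using new[of v y] y v ne by metis
      show False
        using adjacent_centers_common_hole[OF wf nu nv auv H H' ne(1) y(3) ne(2) y(4)] one uv u(2) v(2)
        by metis
    qed
    \<comment> \<open>By \<open>common\<close>, \<open>x\<close> is not a second non-neighbour of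
      \<open>u\<close>, nor \<open>w\<close> of \<open>v\<close>; and \<open>wx\<close>, having no
      end in \<open>C\<close>, is not new. This gives the remaining sides of the square.\<close>
    have a1: "adj G u x" using common[of x] v wx by blast
    have a2: "adj G v w" using common[of w] u wx by blast
    have "x \<noteq> w" using a1 u by auto
    have a3: "adj G w x" using new[of w x] u v wx \<open>x \<noteq> w\<close> by metis
    have "is_hole G {u, v, w, x}"
      using square_hole[OF wf auv a2 a3 _ u(5) v(5)] a1 adj_sym u(4) v(4) by metis
    then show False using one[of "{u, v, w, x}" u v] u v uv by auto
  qed
  show ?thesis
  proof (cases "is_clique G K")
    case True
    then show ?thesis unfolding is_clique_def by blast
  next
    case False
    then obtain x y where "x \<in> K" "y \<in> K" "x \<noteq> y" "\<not> adj G x y" using KV unfolding is_clique_def by blast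
    then obtain u w where u: "u \<in> K" "u \<in> C" "w \<in> K" "w \<noteq> u" "\<not> adj G u w"
      using new adj_sym by metis
    have "adj G a b" if "a \<in> K - {u}" "b \<in> K - {u}" "a \<noteq> b" for a b
    proof (rule ccontr)
      assume n: "\<not> adj G a b"
      then have "a \<in> C \<or> b \<in> C" using new[of a b] that by blast
      then show False
        using key[OF u, of a b] key[OF u, of b a] that n adj_sym[of G a b] by blast
    qed
    then show ?thesis using KV unfolding is_clique_def by blast
  qed
qed

section \<open>Adding chords of holes does not enlarge \<open>Omega\<close>\<close>

lemma hole_arc_avoiding:
  assumes wf: "wf_graph G" and H: "is_hole G H" "p \<in> H" "q \<in> H" "p \<noteq> q"
    and v: "v \<notin> Omega G" and nq: "\<not> adj G v q"
  obtains rs where "rs \<noteq> []" "ipath G rs" "hd rs = p" "last rs = q" "\<forall>r\<in>set rs. r = p \<or> r = q \<or> r \<noteq> v \<and> \<not> adj G v r"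
proof (cases "adj G p q")
  case True
  then show thesis using that[of "[p, q]"] H(4) by auto
next
  case False
  note found = that
  obtain ps where ps: "cyc G p ps" "H = insert p (set ps)" using hole_obtain_cyc[OF H(1,2)] by metis
  have vH: "v \<notin> H" using v H(1) unfolding Omega_def by blast
  obtain A B where AB: "ps = A @ q # B" using ps(2) H(3,4) by (metis insertE split_list)
  have c: "cyc G p (A @ q # B)" using ps AB by simp
  have c': "cyc G p (rev B @ q # rev A)" using cyc_rev[OF c] by simp
  \<comment> \<open>Otherwise the neighbours of \<open>v\<close> closest to \<open>q\<close> on
    either side bound a stretch around \<open>q\<close> that closes with \<open>v\<close> to a hole;
    as \<open>q\<close> is not adjacent to \<open>v\<close>, only the ends of the stretch
    are.\<close>
  have "(\<forall>a\<in>set A. \<not> adj G v a) \<or> (\<forall>a\<in>set B. \<not> adj G v a)"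
  proof (rule ccontr)
    assume "\<not> ?thesis"
    then have e: "\<exists>a\<in>set A. adj G v a" "\<exists>b\<in>set B. adj G v b" by blast+
    obtain A1 x A2 where A: "A = A1 @ x # A2" "adj G v x" "\<forall>a\<in>set A2. \<not> adj G v a"
      using split_list_last_prop[OF e(1)] by metis
    obtain B1 y B2 where B: "B = B1 @ y # B2" "adj G v y" "\<forall>b\<in>set B1. \<not> adj G v b"
      using split_list_first_prop[OF e(2)] by metis
    let ?m = "x # A2 @ q # B1 @ [y]"
    have e: "A @ q # B = A1 @ ?m @ B2" using A B by simp
    have "ipath G ?m" using c unfolding cyc_def e ipath_append by blast
    moreover have "v \<notin> set ?m" using vH ps AB e by auto
    moreover have "\<forall>w\<in>set ?m. adj G v w \<longleftrightarrow> w = hd ?m \<or> w = last ?m"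
      using A(2,3) B(2,3) nq by auto
    ultimately have "cyc G v ?m" unfolding cyc_def by simp
    from cyc_is_hole[OF wf this] show False using v unfolding Omega_def by blast
  qed
  moreover have "thesis" if c: "cyc G p (A' @ q # B')" and A': "\<forall>a\<in>set A'. \<not> adj G v a" "v \<notin> set A'" for A' B'
  proof -
    have n: "\<not> adj G p q" by (rule False)
    note l = cyc_left_side[OF c n]
    have "ipath G (p # A' @ [q])" using l by auto
    then show thesis using found[of "p # A' @ [q]"] A' by auto
  qed
  ultimately show thesis using c c' vH ps AB by auto
qed

text \<open>The edges of the \<open>G'\<close>-path are replaced, from the back, by induced paths of
  \<open>G\<close> inside \<open>W\<close>, each attached with \<open>ipath_join\<close>.\<close>

lemma ipath_chain:
  assumes "ipath G' ps" "ps \<noteq> []"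
    and "\<And>p q. p \<in> set ps \<Longrightarrow> q \<in> set ps \<Longrightarrow> adj G' p q \<Longrightarrow>
       \<exists>rs. rs \<noteq> [] \<and> ipath G rs \<and> hd rs = p \<and> last rs = q \<and> set rs \<subseteq> W"
    and "set ps \<subseteq> W"
  shows "\<exists>rs. rs \<noteq> [] \<and> ipath G rs \<and> hd rs = hd ps \<and> last rs = last ps \<and> set rs \<subseteq> W"
  using assms
proof (induction ps)
  case (Cons x ps)
  show ?case
  proof (cases "ps = []")
    case True
    then show ?thesis using Cons.prems by (intro exI[of _ "[x]"]) auto
  next
    case False
    then obtain rs where rs: "rs \<noteq> []" "ipath G rs" "hd rs = hd ps" "last rs = last ps" "set rs \<subseteq> W"
      using Cons.IH Cons.prems by auto
    have "adj G' x (hd ps)" "hd ps \<in> set (x # ps)" using Cons.prems(1) False by auto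
    then obtain qs where qs: "qs \<noteq> []" "ipath G qs" "hd qs = x" "last qs = hd ps" "set qs \<subseteq> W"
      using Cons.prems(3)[of x "hd ps"] by auto
    then obtain ts where "ts \<noteq> []" "ipath G ts" "hd ts = hd qs" "last ts = last rs" "set ts \<subseteq> set qs \<union> set rs"
      using ipath_join[OF qs(2) rs(2) qs(1) rs(1)] rs(3) by auto
    then show ?thesis using qs rs False by (intro exI[of _ ts]) auto
  qed
qed simp

text \<open>A vertex on no hole of \<open>M\<close> misses one of the two arcs of a hole that close up a new edge,
  so new edges on a hole of \<open>M'\<close> can be replaced by such arcs.\<close>

lemma Omega_add_chords:
  assumes wf: "wf_graph M" and e: "edges M \<subseteq> edges M'"
    and new: "\<And>e. e \<in> edges M' \<Longrightarrow> e \<notin> edges M \<Longrightarrow> \<exists>H. is_hole M H \<and> e \<subseteq> H"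
  shows "Omega M' \<subseteq> Omega M"
proof
  fix v assume "v \<in> Omega M'"
  then obtain H where H: "is_hole M' H" "v \<in> H" unfolding Omega_def by blast
  obtain ps where ps: "cyc M' v ps" using hole_obtain_cyc[OF H] by metis
  have ip: "ipath M' ps" and l: "3 \<le> length ps" and nv: "v \<notin> set ps"
    and av: "\<forall>w\<in>set ps. adj M' v w \<longleftrightarrow> w = hd ps \<or> w = last ps" using ps unfolding cyc_def by blast+
  have mono: "adj M x y \<Longrightarrow> adj M' x y" for x y using e unfolding adj_def by blast
  show "v \<in> Omega M"
  proof (rule ccontr)
    assume v: "v \<notin> Omega M"
    \<comment> \<open>Both ends of a new edge lie on a hole of \<open>M\<close> and \<open>v\<close>
      lies on none, so \<open>v\<close> has the same neighbours in both graphs.\<close>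
    have same: "adj M' v x \<longleftrightarrow> adj M v x" for x
      using mono new[of "{v, x}"] v unfolding adj_def Omega_def by blast
    have ne: "ps \<noteq> []" using l by auto
    have hl: "hd ps \<noteq> last ps \<and> \<not> adj M' (hd ps) (last ps)"
    proof -
      obtain x qs where p: "ps = x # qs" using ne by (cases ps) auto
      then obtain y rs where "qs = y # rs" "rs \<noteq> []" using l by (cases qs; cases "tl qs") auto
      then have q: "qs \<noteq> []" "hd qs \<noteq> last qs"
        using ipath_distinct[OF ip] p last_in_set[of rs] by auto
      have "last qs \<in> set qs" using q by simp
      then show ?thesis using ip p q by auto
    qed
    \<comment> \<open>The vertices a rerouted path may use: \<open>v\<close> is outside
      \<open>W\<close> and has no neighbour in \<open>W\<close> apart from the two ends, so such a
      path will close with \<open>v\<close> to a hole of \<open>M\<close>.\<close>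
    define W where "W = {hd ps, last ps} \<union> {x. x \<noteq> v \<and> \<not> adj M v x}"
    have W: "set ps \<subseteq> W" using av nv same unfolding W_def by auto
    have "\<exists>rs. rs \<noteq> [] \<and> ipath M rs \<and> hd rs = p \<and> last rs = q \<and> set rs \<subseteq> W"
      if pq: "p \<in> set ps" "q \<in> set ps" "adj M' p q" for p q
    proof (cases "adj M p q")
      case True
      then show ?thesis using pq W by (intro exI[of _ "[p, q]"]) auto
    next
      case False
      have pne: "p \<noteq> q" using pq(3) by auto
      have "{p, q} \<in> edges M'" "{p, q} \<notin> edges M" using pq(3) False pne unfolding adj_def by auto
      then obtain F where F: "is_hole M F" "p \<in> F" "q \<in> F" using new[of "{p, q}"] by auto
      \<comment> \<open>The only neighbours of \<open>v\<close> on the path are its ends, which are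
        not adjacent in \<open>M'\<close>; the edge \<open>pq\<close> cannot join them.\<close>
      have "\<not> adj M v p \<or> \<not> adj M v q"
        using av hl pq same adj_sym[of M' p q] pne by metis
      then show ?thesis
      proof
        assume "\<not> adj M v q"
        then obtain rs where "rs \<noteq> []" "ipath M rs" "hd rs = p" "last rs = q"
            "\<forall>r\<in>set rs. r = p \<or> r = q \<or> r \<noteq> v \<and> \<not> adj M v r"
          using hole_arc_avoiding[OF wf F pne v] by metis
        then show ?thesis using pq W by (intro exI[of _ rs]) (auto simp: W_def)
      next
        assume "\<not> adj M v p"
        then obtain rs where "rs \<noteq> []" "ipath M rs" "hd rs = q" "last rs = p"
            "\<forall>r\<in>set rs. r = q \<or> r = p \<or> r \<noteq> v \<and> \<not> adj M v r"
          using hole_arc_avoiding[OF wf F(1,3,2) pne[symmetric] v] by metis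
        then show ?thesis using pq W
          by (intro exI[of _ "rev rs"]) (auto simp: W_def ipath_rev hd_rev last_rev)
      qed
    qed
    then obtain rs where rs: "rs \<noteq> []" "ipath M rs" "hd rs = hd ps" "last rs = last ps" "set rs \<subseteq> W"
      using ipath_chain[OF ip ne _ W] by metis
    have vW: "v \<notin> W" using nv ne unfolding W_def by auto
    \<comment> \<open>On a shorter path the ends would coincide or be adjacent.\<close>
    have "3 \<le> length rs"
    proof (rule ccontr)
      assume "\<not> ?thesis"
      then have "length rs = 1 \<or> length rs = 2" using length_0_conv[of rs] rs(1) by linarith
      then obtain a b where "rs = [a] \<or> rs = [a, b]" by (auto simp: length_Suc_conv numeral_2_eq_2)
      then show False using rs hl mono by auto
    qed
    moreover have "adj M v w \<longleftrightarrow> w = hd rs \<or> w = last rs" if "w \<in> set rs" for w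
      using that rs(3-5) av same ne unfolding W_def by auto
    ultimately have "cyc M v rs" using rs(2,5) vW unfolding cyc_def by blast
    from cyc_is_hole[OF wf this] show False using v unfolding Omega_def by blast
  qed
qed

section \<open>Iterating over a local chordalization partition\<close>

lemma verts_Pair [simp]: "verts (V, E) = V" and edges_Pair [simp]: "edges (V, E) = E"
  by (simp_all add: verts_def edges_def)

lemma verts_delete [simp]: "verts (delete G S) = verts G - S"
  and edges_delete [simp]: "edges (delete G S) = {e \<in> edges G. e \<inter> S = {}}"
  by (simp_all add: delete_def)

lemma wf_edgeE:
  assumes "wf_graph G" "e \<in> edges G"
  obtains u v where "u \<noteq> v" "e = {u, v}" "u \<in> verts G" "v \<in> verts G"
proof -
  have "\<exists>u v. u \<noteq> v \<and> e = {u, v} \<and> u \<in> verts G \<and> v \<in> verts G"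
    using assms unfolding wf_graph_def by simp
  then show thesis using that by (elim exE conjE)
qed

lemma wf_edge_subset:
  assumes "wf_graph G" "e \<in> edges G" shows "e \<subseteq> verts G"
  by (rule wf_edgeE[OF assms]) simp

lemma wf_graph_union:
  assumes "wf_graph G" "finite V" "verts G \<subseteq> V" "\<And>e. e \<in> E \<Longrightarrow> \<exists>u v. u \<noteq> v \<and> e = {u, v} \<and> u \<in> V \<and> v \<in> V"
  shows "wf_graph (V, edges G \<union> E)"
  unfolding wf_graph_def
proof (intro conjI ballI)
  show "finite (verts (V, edges G \<union> E))" using assms(2) by simp
  fix e assume "e \<in> edges (V, edges G \<union> E)"
  then consider "e \<in> edges G" | "e \<in> E" by auto
  then have "\<exists>u v. u \<noteq> v \<and> e = {u, v} \<and> u \<in> V \<and> v \<in> V"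
  proof cases
    case 1
    then obtain u v where "u \<noteq> v" "e = {u, v}" "u \<in> verts G" "v \<in> verts G"
      using wf_edgeE[OF assms(1)] by metis
    then show ?thesis using assms(3) by blast
  qed (rule assms(4))
  then show "\<exists>u v. u \<noteq> v \<and> e = {u, v} \<and> u \<in> verts (V, edges G \<union> E) \<and> v \<in> verts (V, edges G \<union> E)"
    by simp
qed

text \<open>The premises are the invariant of the induction along the remaining parts:
  \<open>Gs\<close> lives on \<open>G\<close> without these parts and contains all edges of
  \<open>G\<close> there; its new edges lie in \<open>Omega G\<close>, adding them to
  \<open>G\<close> does not enlarge \<open>Omega\<close>, and deleting at most \<open>k\<close>
  vertices turns a clique of \<open>Gs\<close> into one of \<open>G\<close>. Each part raises
  \<open>k\<close> by one.\<close>

lemma lcp_completion: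
  assumes wfG: "wf_graph G" and "lcp_ok G Gs Cs" "wf_graph Gs" "verts Gs = verts G - \<Union> (set Cs)"
    "\<forall>X\<in>set Cs. X \<subseteq> verts G" "sorted_wrt (\<lambda>X Y. X \<inter> Y = {}) Cs"
    "edges (delete G (\<Union> (set Cs))) \<subseteq> edges Gs" "Cs = [] \<longrightarrow> chordal Gs"
    "\<forall>e\<in>edges Gs. e \<notin> edges G \<longrightarrow> e \<subseteq> Omega G"
    "Omega (verts G, edges G \<union> edges Gs) \<subseteq> Omega G"
    "\<forall>K. is_clique Gs K \<longrightarrow> (\<exists>U. finite U \<and> card U \<le> k \<and> is_clique G (K - U))"
  shows "\<exists>Gt. chordal_completion G Gt \<and> (\<forall>e\<in>edges Gt. e \<notin> edges G \<longrightarrow> e \<subseteq> Omega G) \<and>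
     (\<forall>K. is_clique Gt K \<longrightarrow> (\<exists>U. finite U \<and> card U \<le> k + length Cs \<and> is_clique G (K - U)))"
  using assms(2-)
proof (induction Cs arbitrary: Gs k)
  case Nil
  have "edges (delete G {}) = edges G" by simp
  then have "chordal_completion G Gs" using Nil.prems unfolding chordal_completion_def by simp
  then show ?case using Nil.prems by (intro exI[of _ Gs]) simp
next
  case (Cons C Cs)
  define R where "R = \<Union> (set Cs)"
  define Gi where "Gi = (verts Gs \<union> C, edges Gs \<union> edges (delete G R))"
  define Gt where "Gt = hat Gi C"
  have ok: "hole_cover Gi C" "NC_set Gi C" "chordal Gt" "lcp_ok G Gt Cs"
    using Cons.prems(1) unfolding lcp_ok.simps Let_def Gt_def Gi_def R_def by blast+
  have C: "C \<subseteq> verts G" "C \<inter> R = {}" using Cons.prems(4,5) unfolding R_def by auto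
  have VGs: "verts Gs = verts G - (C \<union> R)" using Cons.prems(3) unfolding R_def by auto
  have VGi: "verts Gi = verts G - R" using C VGs unfolding Gi_def by auto
  have fin: "finite (verts G)" using wfG unfolding wf_graph_def by blast
  have EGi: "edges Gi = edges Gs \<union> {e \<in> edges G. e \<inter> R = {}}" unfolding Gi_def by simp
  have wfi: "wf_graph Gi"
    unfolding Gi_def
  proof (rule wf_graph_union)
    show "wf_graph Gs" by (rule Cons.prems(2))
    show "finite (verts Gs \<union> C)" using fin VGs C by (metis finite_Diff finite_UnI finite_subset)
    fix e assume "e \<in> edges (delete G R)"
    then have e: "e \<in> edges G" "e \<inter> R = {}" by auto
    from wfG e(1) obtain u v where "u \<noteq> v" "e = {u, v}" "u \<in> verts G" "v \<in> verts G" by (rule wf_edgeE)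
    then show "\<exists>u v. u \<noteq> v \<and> e = {u, v} \<and> u \<in> verts Gs \<union> C \<and> v \<in> verts Gs \<union> C"
      using e(2) VGs by (intro exI[of _ u] exI[of _ v]) auto
  qed simp
  \<comment> \<open>\<open>G\<close> with all edges added so far. \<open>Gi\<close> is its induced
    subgraph on \<open>verts G - R\<close>, so holes of \<open>Gi\<close> are holes of
    \<open>M\<close>, and the next new edges are chords of holes of \<open>M\<close>.\<close>
  define M where "M = (verts G, edges G \<union> edges Gs)"
  have wfM: "wf_graph M"
    unfolding M_def
  proof (rule wf_graph_union[OF wfG fin subset_refl])
    fix e assume "e \<in> edges Gs"
    with Cons.prems(2) obtain u v where "u \<noteq> v" "e = {u, v}" "u \<in> verts Gs" "v \<in> verts Gs" by (rule wf_edgeE)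
    then show "\<exists>u v. u \<noteq> v \<and> e = {u, v} \<and> u \<in> verts G \<and> v \<in> verts G"
      using VGs by (intro exI[of _ u] exI[of _ v]) auto
  qed
  have holeM: "is_hole M H" if H: "is_hole Gi H" for H
  proof -
    have HV: "H \<subseteq> verts Gi" using H by (rule hole_verts)
    have "is_hole Gi H \<longleftrightarrow> is_hole M H"
    proof (rule hole_cong)
      show "H \<subseteq> verts Gi \<longleftrightarrow> H \<subseteq> verts M" using HV VGi unfolding M_def by auto
      fix x y assume "x \<in> H" "y \<in> H"
      then have "{x, y} \<inter> R = {}" using HV VGi by auto
      then show "adj Gi x y \<longleftrightarrow> adj M x y" unfolding adj_def M_def EGi by auto
    qed
    then show ?thesis using H by simp
  qed
  have CVi: "C \<subseteq> verts Gi" unfolding Gi_def by simp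
  note hp = hat_props[OF wfi CVi ok(2), folded Gt_def]
  have newt: "\<exists>H. is_hole M H \<and> e \<subseteq> H" if "e \<in> edges Gt" "e \<notin> edges Gi" for e
    using hp(4)[OF that] holeM by blast
  have "Omega (verts G, edges G \<union> edges Gt) \<subseteq> Omega M"
  proof (rule Omega_add_chords[OF wfM])
    show "edges M \<subseteq> edges (verts G, edges G \<union> edges Gt)" using hp(3) unfolding M_def EGi by auto
    fix e assume "e \<in> edges (verts G, edges G \<union> edges Gt)" "e \<notin> edges M"
    then show "\<exists>H. is_hole M H \<and> e \<subseteq> H" using newt[of e] unfolding M_def EGi by auto
  qed
  moreover have OM: "Omega M \<subseteq> Omega G" using Cons.prems(9) unfolding M_def .
  ultimately have Om: "Omega (verts G, edges G \<union> edges Gt) \<subseteq> Omega G" by blast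
  have new: "\<forall>e\<in>edges Gt. e \<notin> edges G \<longrightarrow> e \<subseteq> Omega G"
  proof (intro ballI impI)
    fix e assume e: "e \<in> edges Gt" "e \<notin> edges G"
    show "e \<subseteq> Omega G"
    proof (cases "e \<in> edges Gi")
      case True
      then show ?thesis using e Cons.prems(8) unfolding EGi by blast
    next
      case False
      then obtain H where "is_hole M H" "e \<subseteq> H" using newt e by blast
      then show ?thesis using OM unfolding Omega_def by blast
    qed
  qed
  \<comment> \<open>\<open>hat_clique\<close> removes \<open>u\<close>, and the invariant applied
    outside \<open>C\<close> removes \<open>U\<close>. The other vertices of \<open>C\<close> may
    stay: \<open>Gs\<close> has no vertex in \<open>C\<close>, so edges of \<open>Gi\<close> ending
    there are edges of \<open>G\<close>.\<close>
  have cl: "\<forall>K. is_clique Gt K \<longrightarrow> (\<exists>U. finite U \<and> card U \<le> Suc k \<and> is_clique G (K - U))"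
  proof (intro allI impI)
    fix K assume "is_clique Gt K"
    then obtain u where K1: "is_clique Gi (K - {u})" using hat_clique[OF wfi CVi ok(2)] unfolding Gt_def by blast
    have "is_clique Gs (K - {u} - C)"
      unfolding is_clique_def
    proof (intro conjI ballI impI)
      show "K - {u} - C \<subseteq> verts Gs" using K1 unfolding is_clique_def Gi_def by auto
      fix x y assume xy: "x \<in> K - {u} - C" "y \<in> K - {u} - C" "x \<noteq> y"
      then have "{x, y} \<in> edges Gi" using K1 unfolding is_clique_def adj_def by blast
      then have "{x, y} \<in> edges Gs"
      proof (cases "{x, y} \<in> edges Gs")
        case False
        then have "{x, y} \<in> edges G" "{x, y} \<inter> R = {}" using \<open>{x, y} \<in> edges Gi\<close> unfolding EGi by auto
        then have "{x, y} \<in> edges (delete G (\<Union> (set (C # Cs))))" using xy unfolding R_def by auto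
        then show ?thesis using Cons.prems(6) by blast
      qed
      then show "adj Gs x y" using xy unfolding adj_def by blast
    qed
    then obtain U where U: "finite U" "card U \<le> k" "is_clique G (K - {u} - C - U)" using Cons.prems(10) by blast
    have "is_clique G (K - insert u U)"
      unfolding is_clique_def
    proof (intro conjI ballI impI)
      show "K - insert u U \<subseteq> verts G" using K1 VGi unfolding is_clique_def by auto
      fix x y assume xy: "x \<in> K - insert u U" "y \<in> K - insert u U" "x \<noteq> y"
      show "adj G x y"
      proof (cases "x \<in> C \<or> y \<in> C")
        case False
        then show ?thesis using U(3) xy unfolding is_clique_def by blast
      next
        case True
        have e: "{x, y} \<in> edges Gi" using K1 xy unfolding is_clique_def adj_def by blast
        have "{x, y} \<notin> edges Gs" using wf_edge_subset[OF Cons.prems(2)] True VGs by blast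
        then show ?thesis using e xy(3) unfolding EGi adj_def by blast
      qed
    qed
    moreover have "card (insert u U) \<le> Suc k" using U by (simp add: card_insert_if)
    ultimately show "\<exists>U. finite U \<and> card U \<le> Suc k \<and> is_clique G (K - U)" using U(1) by blast
  qed
  have "\<exists>Gu. chordal_completion G Gu \<and> (\<forall>e\<in>edges Gu. e \<notin> edges G \<longrightarrow> e \<subseteq> Omega G) \<and>
     (\<forall>K. is_clique Gu K \<longrightarrow> (\<exists>U. finite U \<and> card U \<le> Suc k + length Cs \<and> is_clique G (K - U)))"
  proof (rule Cons.IH[OF ok(4) hp(2) _ _ _ _ _ new Om cl])
    show "verts Gt = verts G - \<Union> (set Cs)" using hp(1) VGi unfolding R_def by simp
    show "\<forall>X\<in>set Cs. X \<subseteq> verts G" using Cons.prems(4) by simp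
    show "sorted_wrt (\<lambda>X Y. X \<inter> Y = {}) Cs" using Cons.prems(5) by simp
    show "edges (delete G (\<Union> (set Cs))) \<subseteq> edges Gt" using hp(3) unfolding EGi R_def by auto
    show "Cs = [] \<longrightarrow> chordal Gt" using ok(3) by simp
  qed
  then show ?case by simp
qed

text \<open>The induction starts from \<open>delete G C\<close> with \<open>k = 0\<close>: this
  graph has no edge outside \<open>G\<close>, and its cliques are cliques of
  \<open>G\<close>.\<close>

lemma partition_completion:
  assumes wf: "wf_graph G" and p: "local_chordalization_partition G C Cs"
  shows "\<exists>Gt. chordal_completion G Gt \<and> (\<forall>e\<in>edges Gt. e \<notin> edges G \<longrightarrow> e \<subseteq> Omega G) \<and>
     (\<forall>K. is_clique Gt K \<longrightarrow> (\<exists>U. finite U \<and> card U \<le> length Cs \<and> is_clique G (K - U)))"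
proof -
  have C: "hole_cover G C" "Cs \<noteq> []" "\<Union> (set Cs) = C" "lcp_ok G (delete G C) Cs"
    and dj: "\<forall>i < length Cs. \<forall>j < length Cs. i \<noteq> j \<longrightarrow> Cs ! i \<inter> Cs ! j = {}"
    using p unfolding local_chordalization_partition_def by blast+
  have CV: "C \<subseteq> verts G" using C(1) unfolding hole_cover_def by blast
  have eq: "(verts G, edges G \<union> edges (delete G C)) = G"
    by (auto simp: verts_def edges_def delete_def prod_eq_iff)
  have wfd: "wf_graph (delete G C)"
    unfolding wf_graph_def
  proof (intro conjI ballI)
    show "finite (verts (delete G C))" using wf unfolding wf_graph_def by simp
    fix e assume "e \<in> edges (delete G C)"
    then have e: "e \<in> edges G" "e \<inter> C = {}" by auto
    from wf e(1) obtain u v where "u \<noteq> v" "e = {u, v}" "u \<in> verts G" "v \<in> verts G" by (rule wf_edgeE)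
    then show "\<exists>u v. u \<noteq> v \<and> e = {u, v} \<and> u \<in> verts (delete G C) \<and> v \<in> verts (delete G C)"
      using e(2) by (intro exI[of _ u] exI[of _ v]) auto
  qed
  have cl: "\<forall>K. is_clique (delete G C) K \<longrightarrow> (\<exists>U. finite U \<and> card U \<le> 0 \<and> is_clique G (K - U))"
  proof (intro allI impI)
    fix K assume "is_clique (delete G C) K"
    then have "is_clique G (K - {})" unfolding is_clique_def adj_def by auto
    then show "\<exists>U. finite U \<and> card U \<le> 0 \<and> is_clique G (K - U)" by (intro exI[of _ "{}"]) simp
  qed
  have "\<exists>Gt. chordal_completion G Gt \<and> (\<forall>e\<in>edges Gt. e \<notin> edges G \<longrightarrow> e \<subseteq> Omega G) \<and>
     (\<forall>K. is_clique Gt K \<longrightarrow> (\<exists>U. finite U \<and> card U \<le> 0 + length Cs \<and> is_clique G (K - U)))"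
  proof (rule lcp_completion[OF wf C(4) wfd _ _ _ _ _ _ _ cl])
    show "sorted_wrt (\<lambda>X Y. X \<inter> Y = {}) Cs" using dj by (simp add: sorted_wrt_iff_nth_less)
    show "Omega (verts G, edges G \<union> edges (delete G C)) \<subseteq> Omega G" unfolding eq by simp
  qed (use C CV in auto)
  then show ?thesis by simp
qed

section \<open>Simplicial vertices and DP-colouring\<close>

lemma clique_le_clique_num:
  assumes "wf_graph G" "is_clique G K"
  shows "card K \<le> clique_num G"
proof -
  have "{card K | K. is_clique G K} \<subseteq> card ` Pow (verts G)" unfolding is_clique_def by blast
  then have "finite {card K | K. is_clique G K}"
    using assms(1) unfolding wf_graph_def by (meson finite_Pow_iff finite_imageI finite_subset)
  then show ?thesis unfolding clique_num_def using assms(2) by (intro Max_ge) auto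
qed

lemma clique_num_attained:
  assumes "wf_graph G"
  obtains K where "is_clique G K" "card K = clique_num G"
proof -
  have "{card K | K. is_clique G K} \<subseteq> card ` Pow (verts G)" unfolding is_clique_def by blast
  then have f: "finite {card K | K. is_clique G K}"
    using assms(1) unfolding wf_graph_def by (meson finite_Pow_iff finite_imageI finite_subset)
  have "is_clique G {}" unfolding is_clique_def by simp
  then have "{card K | K. is_clique G K} \<noteq> {}" by blast
  from Max_in[OF f this] show thesis using that unfolding clique_num_def by auto
qed

text \<open>Taken relative to the subgraph induced on \<open>W\<close>, so that an induction can
  shrink \<open>W\<close> while \<open>G\<close> stays fixed.\<close>

definition simplicial :: "'a graph \<Rightarrow> 'a set \<Rightarrow> 'a \<Rightarrow> bool" where
  "simplicial G W s \<longleftrightarrow> (\<forall>a\<in>W. \<forall>b\<in>W. adj G s a \<longrightarrow> adj G s b \<longrightarrow> a \<noteq> b \<longrightarrow> adj G a b)"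

text \<open>Dirac: the attachments of a component \<open>D\<close> of the non-neighbours of \<open>v\<close> form a clique, so that
  induction applies to \<open>D\<close> together with its attachments.\<close>

lemma simplicial_nonneighbour:
  assumes wf: "wf_graph G" and ch: "chordal G"
    and "finite W" "v \<in> W" "x \<in> W" "x \<noteq> v" "\<not> adj G v x"
  shows "\<exists>s\<in>W. s \<noteq> v \<and> \<not> adj G v s \<and> simplicial G W s"
  using assms(3-)
proof (induction "card W" arbitrary: W v x rule: less_induct)
  case less
  \<comment> \<open>\<open>Z\<close> consists of the non-neighbours of \<open>v\<close>,
    \<open>D\<close> is the component of \<open>x\<close> in \<open>Z\<close>, described by induced
    paths, and \<open>N\<close> collects the attachments of \<open>D\<close>.\<close>
  define Z where "Z = {w \<in> W. w \<noteq> v \<and> \<not> adj G v w}"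
  define D where "D = {d. \<exists>qs. qs \<noteq> [] \<and> ipath G qs \<and> hd qs = x \<and> last qs = d \<and> set qs \<subseteq> Z}"
  define N where "N = {y \<in> W. y \<notin> D \<and> (\<exists>d\<in>D. adj G y d)}"
  have DZ: "D \<subseteq> Z" unfolding D_def by auto
  have "\<exists>qs. qs \<noteq> [] \<and> ipath G qs \<and> hd qs = x \<and> last qs = x \<and> set qs \<subseteq> Z"
    using less.prems by (intro exI[of _ "[x]"]) (auto simp: Z_def)
  then have xD: "x \<in> D" unfolding D_def by blast
  have step: "y \<in> D" if yd: "y \<in> Z" "d \<in> D" "adj G y d" for y d
  proof -
    obtain qs where qs: "qs \<noteq> []" "ipath G qs" "hd qs = x" "last qs = d" "set qs \<subseteq> Z"
      using yd(2) unfolding D_def by blast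
    have "touch G y (set (rev qs))" using yd(3) qs(1,4) unfolding touch_def by auto
    moreover have "ipath G (rev qs)" using qs(2) by (simp add: ipath_rev)
    ultimately obtain q' where q': "ipath G (y # q')" "set q' \<subseteq> set (rev qs)" "last (y # q') = last (rev qs)"
      using ipath_touch_extend by metis
    have "ipath G (rev (y # q'))" using q'(1) by (simp only: ipath_rev)
    moreover have "hd (rev (y # q')) = x" using q'(3) qs(1,3) by (metis hd_rev last_rev)
    moreover have "last (rev (y # q')) = y" by simp
    moreover have "set (rev (y # q')) \<subseteq> Z" using q'(2) qs(5) yd(1) by auto
    ultimately show ?thesis unfolding D_def by (auto intro!: exI[of _ "rev (y # q')"])
  qed
  have vZ: "v \<notin> Z" unfolding Z_def by simp
  \<comment> \<open>An attachment not adjacent to \<open>v\<close> would lie in \<open>Z\<close>,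
    hence in \<open>D\<close> by \<open>step\<close>.\<close>
  have Nv: "adj G v y" if y: "y \<in> N" for y
  proof -
    obtain d where d: "d \<in> D" "adj G y d" "y \<in> W" "y \<notin> D" using y unfolding N_def by blast
    then have "y \<noteq> v" using DZ unfolding Z_def by auto
    then show ?thesis using d step[of y d] unfolding Z_def by blast
  qed
  \<comment> \<open>Two non-adjacent attachments, linked through \<open>D\<close>, would close with
    \<open>v\<close> to a hole.\<close>
  have Ncl: "adj G y z" if yz: "y \<in> N" "z \<in> N" "y \<noteq> z" for y z
  proof (rule ccontr)
    assume na: "\<not> adj G y z"
    obtain d where d: "d \<in> D" "adj G y d" using yz(1) unfolding N_def by blast
    obtain e where e: "e \<in> D" "adj G z e" using yz(2) unfolding N_def by blast
    obtain p where p: "p \<noteq> []" "ipath G p" "hd p = x" "last p = d" "set p \<subseteq> Z" using d(1) unfolding D_def by blast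
    obtain q where q: "q \<noteq> []" "ipath G q" "hd q = x" "last q = e" "set q \<subseteq> Z" using e(1) unfolding D_def by blast
    have "ipath G (rev p)" using p(2) by (simp add: ipath_rev)
    then obtain rs where rs: "rs \<noteq> []" "ipath G rs" "hd rs = d" "last rs = e" "set rs \<subseteq> Z"
      using ipath_join[of G "rev p" q] p q by (auto simp: last_rev hd_rev)
    have "touch G y (set rs)" "touch G z (set rs)"
      using rs(1,3,4) d(2) e(2) hd_in_set[OF rs(1)] last_in_set[OF rs(1)] unfolding touch_def by auto
    then obtain zs where zs: "zs \<noteq> []" "set zs \<subseteq> set rs" "ipath G (y # zs @ [z])"
      using ipath_link[OF rs(2) _ _ yz(3) na] by metis
    have "\<forall>w\<in>set zs. w \<noteq> v \<and> \<not> adj G v w" using zs(2) rs(5) unfolding Z_def by blast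
    moreover have "adj G v y" "adj G v z" using Nv yz by auto
    ultimately have "cyc G v (y # zs @ [z])"
      unfolding cyc_def using zs(1,3) by (cases zs) auto
    from cyc_is_hole[OF wf this] show False using ch unfolding chordal_def by blast
  qed
  define W' where "W' = D \<union> N"
  have W'W: "W' \<subseteq> W" using DZ unfolding W'_def N_def Z_def by blast
  have "v \<notin> W'" using vZ DZ Nv[of v] unfolding W'_def by auto
  then have lt: "card W' < card W" using W'W less.prems(1,2) by (intro psubset_card_mono) auto
  have fin: "finite W'" using W'W less.prems(1) finite_subset by blast
  \<comment> \<open>Induction at \<open>p\<close> gives a simplicial \<open>s\<close> not adjacent
    to \<open>p\<close>. If \<open>p\<close> is in \<open>N\<close>, then \<open>s\<close> is in
    \<open>D\<close> because \<open>N\<close> is a clique. If no vertex of \<open>N\<close> has a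
    non-neighbour in \<open>W'\<close>, then \<open>p\<close> is taken in \<open>D\<close> and
    \<open>s\<close> cannot be in \<open>N\<close>. If no \<open>p\<close> exists, \<open>W'\<close>
    is a clique and \<open>x\<close> serves.\<close>
  have "\<exists>s\<in>D. simplicial G W' s"
  proof (cases "\<exists>p\<in>N. \<exists>q\<in>W'. q \<noteq> p \<and> \<not> adj G p q")
    case True
    then obtain p q where pq: "p \<in> N" "q \<in> W'" "q \<noteq> p" "\<not> adj G p q" by blast
    then obtain s where "s \<in> W'" "s \<noteq> p" "\<not> adj G p s" "simplicial G W' s"
      using less.hyps[OF lt fin _ pq(2-4)] unfolding W'_def by blast
    then show ?thesis using Ncl pq(1) unfolding W'_def by blast
  next
    case A: False
    show ?thesis
    proof (cases "\<exists>p\<in>D. \<exists>q\<in>W'. q \<noteq> p \<and> \<not> adj G p q")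
      case True
      then obtain p q where pq: "p \<in> D" "q \<in> W'" "q \<noteq> p" "\<not> adj G p q" by blast
      then obtain s where s: "s \<in> W'" "s \<noteq> p" "\<not> adj G p s" "simplicial G W' s"
        using less.hyps[OF lt fin _ pq(2-4)] unfolding W'_def by blast
      have "s \<notin> N"
      proof
        assume "s \<in> N"
        moreover have "p \<in> W'" using pq(1) unfolding W'_def by blast
        moreover have "\<not> adj G s p" using s(3) adj_sym[of G p s] by simp
        ultimately show False using A s(2) by metis
      qed
      then show ?thesis using s(1,4) unfolding W'_def by blast
    next
      case False
      then have "\<forall>p\<in>W'. \<forall>q\<in>W'. q \<noteq> p \<longrightarrow> adj G p q" using A unfolding W'_def by blast
      then have "simplicial G W' x" unfolding simplicial_def by metis
      then show ?thesis using xD by blast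
    qed
  qed
  then obtain s where s: "s \<in> D" "simplicial G W' s" by blast
  \<comment> \<open>All neighbours in \<open>W\<close> of a vertex of \<open>D\<close> lie in
    \<open>W'\<close>, so simpliciality lifts from \<open>W'\<close> to \<open>W\<close>.\<close>
  have "a \<in> W'" if "a \<in> W" "adj G s a" for a
    using that s(1) adj_sym[of G s a] unfolding W'_def N_def by blast
  then have "simplicial G W s" using s(2) unfolding simplicial_def by blast
  moreover have "s \<in> W" "s \<noteq> v" "\<not> adj G v s" using s(1) DZ unfolding Z_def by auto
  ultimately show ?case by blast
qed

lemma chordal_simplicial:
  assumes wf: "wf_graph G" and ch: "chordal G" and W: "finite W" "W \<noteq> {}"
  shows "\<exists>s\<in>W. simplicial G W s"
proof (cases "\<exists>v\<in>W. \<exists>x\<in>W. x \<noteq> v \<and> \<not> adj G v x")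
  case True
  then show ?thesis using simplicial_nonneighbour[OF wf ch W(1)] by blast
next
  case False
  then have "simplicial G W s" for s unfolding simplicial_def by metis
  then show ?thesis using W(2) by blast
qed

text \<open>Greedy colouring: colour \<open>W - {s}\<close> first; each of the fewer than
  \<open>k\<close> neighbours of \<open>s\<close> then forbids at most one colour at
  \<open>s\<close>, since the cover is a matching on every edge.\<close>

lemma dp_colorable_degenerate:
  assumes wf: "wf_graph G"
    and deg: "\<And>W. W \<subseteq> verts G \<Longrightarrow> W \<noteq> {} \<Longrightarrow> \<exists>s\<in>W. card {u \<in> W. adj G s u} < k"
  shows "dp_colorable G k"
  unfolding dp_colorable_def
proof (intro allI impI)
  fix M assume M: "dp_cover G k M"
  have fin: "finite (verts G)" using wf unfolding wf_graph_def by blast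
  have "\<exists>f. (\<forall>v\<in>W. f v < k) \<and> (\<forall>u\<in>W. \<forall>v\<in>W. adj G u v \<longrightarrow> \<not> M u v (f u) (f v))" if "W \<subseteq> verts G" for W
    using that
  proof (induction "card W" arbitrary: W rule: less_induct)
    case less
    show ?case
    proof (cases "W = {}")
      case False
      have fW: "finite W" using less.prems fin finite_subset by blast
      obtain s where s: "s \<in> W" "card {u \<in> W. adj G s u} < k" using deg[OF less.prems False] by blast
      have "card (W - {s}) < card W" using s(1) fW by (intro psubset_card_mono) auto
      then obtain f where f: "\<forall>v\<in>W - {s}. f v < k"
        "\<forall>u\<in>W - {s}. \<forall>v\<in>W - {s}. adj G u v \<longrightarrow> \<not> M u v (f u) (f v)"
        using less.hyps[of "W - {s}"] less.prems by blast
      define Bad where "Bad = {j. \<exists>u\<in>W. adj G s u \<and> M u s (f u) j}"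
      have cov: "(M a b i j \<longleftrightarrow> M b a j i) \<and> (M a b i j \<and> M a b i j' \<longrightarrow> j = j')" if "adj G a b" for a b i j j'
        using M that unfolding dp_cover_def by blast
      \<comment> \<open>The forbidden colour is a function of the neighbour, so \<open>Bad\<close>
        is no larger than the neighbourhood of \<open>s\<close> in \<open>W\<close>.\<close>
      have "Bad \<subseteq> (\<lambda>u. THE j. M u s (f u) j) ` {u \<in> W. adj G s u}"
      proof
        fix j assume "j \<in> Bad"
        then obtain u where u: "u \<in> W" "adj G s u" "M u s (f u) j" unfolding Bad_def by blast
        have "adj G u s" using u(2) adj_sym by metis
        then have "(THE j. M u s (f u) j) = j" using u(3) cov by (intro the_equality) blast+
        then show "j \<in> (\<lambda>u. THE j. M u s (f u) j) ` {u \<in> W. adj G s u}" using u by (intro image_eqI[of _ _ u]) auto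
      qed
      then have "card Bad \<le> card {u \<in> W. adj G s u}" "finite Bad"
        using fW by (auto intro: surj_card_le finite_subset)
      then have "\<not> {..<k} \<subseteq> Bad" using s(2) card_mono[of Bad "{..<k}"] by auto
      then obtain c where c: "c < k" "c \<notin> Bad" by auto
      have sv: "\<not> M v s (f v) c" "\<not> M s v c (f v)" if "v \<in> W" "adj G s v" for v
        using c(2) that cov[OF that(2)] unfolding Bad_def by blast+
      have "\<forall>v\<in>W. (f(s := c)) v < k" using f(1) c(1) by auto
      moreover have "\<not> M u v ((f(s := c)) u) ((f(s := c)) v)" if "u \<in> W" "v \<in> W" "adj G u v" for u v
      proof -
        have "u \<noteq> v" using that(3) by auto
        consider "u = s" | "v = s" | "u \<noteq> s" "v \<noteq> s" by blast
        then show ?thesis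
        proof cases
          case 1
          then show ?thesis using sv(2)[of v] that \<open>u \<noteq> v\<close> by auto
        next
          case 2
          then show ?thesis using sv(1)[of u] that \<open>u \<noteq> v\<close> adj_sym[of G u v] by auto
        next
          case 3
          then show ?thesis using f(2) that by auto
        qed
      qed
      ultimately show ?thesis by blast
    qed simp
  qed
  from this[OF subset_refl] show "\<exists>f. (\<forall>v\<in>verts G. f v < k) \<and> (\<forall>u v. adj G u v \<longrightarrow> \<not> M u v (f u) (f v))"
    using adj_verts[OF wf] by meson
qed

text \<open>A simplicial vertex of \<open>Gt\<close> in \<open>W\<close> forms a clique with its
  neighbours in \<open>W\<close>, so its degree there is below \<open>clique_num Gt\<close>, and the
  degree in \<open>G\<close> is no larger.\<close>

lemma chi_DP_le_chordal_completion:
  assumes wf: "wf_graph G" and cc: "chordal_completion G Gt"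
  shows "chi_DP G \<le> clique_num Gt"
proof -
  have t: "wf_graph Gt" "verts Gt = verts G" "edges G \<subseteq> edges Gt" "chordal Gt"
    using cc unfolding chordal_completion_def by blast+
  have fin: "finite (verts G)" using wf unfolding wf_graph_def by blast
  have "dp_colorable G (clique_num Gt)"
  proof (rule dp_colorable_degenerate[OF wf])
    fix W assume W: "W \<subseteq> verts G" "W \<noteq> {}"
    have fW: "finite W" using W(1) fin finite_subset by blast
    obtain s where s: "s \<in> W" "simplicial Gt W s" using chordal_simplicial[OF t(1,4) fW W(2)] by blast
    let ?N = "{u \<in> W. adj Gt s u}"
    have "adj Gt a b" if "a \<in> insert s ?N" "b \<in> insert s ?N" "a \<noteq> b" for a b
      using that s(2) adj_sym[of Gt a b] unfolding simplicial_def by blast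
    then have "is_clique Gt (insert s ?N)"
      using W(1) s(1) t(2) unfolding is_clique_def by auto
    then have "card (insert s ?N) \<le> clique_num Gt" by (rule clique_le_clique_num[OF t(1)])
    moreover have "card (insert s ?N) = Suc (card ?N)" using fW by simp
    moreover have "card {u \<in> W. adj G s u} \<le> card ?N"
      using fW t(3) unfolding adj_def by (intro card_mono) auto
    ultimately show "\<exists>s\<in>W. card {u \<in> W. adj G s u} < clique_num Gt" using s(1) by (intro bexI[of _ s]) auto
  qed
  then show ?thesis unfolding chi_DP_def by (rule Least_le)
qed

text \<open>On \<open>enat\<close> the infimum of a nonempty set is its least element and that of
  the empty set is \<open>\<infinity>\<close>, so a finite index belongs to an actual
  partition.\<close>

lemma nc_index_attained:
  assumes "\<not> chordal G" "nc_index G \<noteq> \<infinity>"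
  obtains C Cs where "local_chordalization_partition G C Cs" "nc_index G = enat (length Cs)"
proof -
  let ?S = "{enat l | l. \<exists>C Cs. length Cs = l \<and> local_chordalization_partition G C Cs}"
  have i: "nc_index G = Inf ?S" using assms(1) unfolding nc_index_def by simp
  have ne: "?S \<noteq> {}"
  proof
    assume "?S = {}"
    then have "nc_index G = \<infinity>" unfolding i by (simp add: Inf_enat_def)
    then show False using assms(2) by simp
  qed
  then have "(LEAST x. x \<in> ?S) \<in> ?S" by (meson LeastI ex_in_conv)
  then have "nc_index G \<in> ?S" using i ne by (simp only: Inf_enat_def if_False)
  then show thesis using that by blast
qed

section \<open>Conclusion: a large clique, counted inside and outside \<open>Omega G\<close>\<close>

lemma wf_induced:
  assumes "wf_graph G" shows "wf_graph (induced G S)"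
  unfolding wf_graph_def
proof (intro conjI ballI)
  show "finite (verts (induced G S))" using assms by (simp add: wf_graph_def induced_def)
  fix e assume "e \<in> edges (induced G S)"
  then have e: "e \<in> edges G" "e \<subseteq> S" by (auto simp: induced_def)
  from assms e(1) obtain u v where "u \<noteq> v" "e = {u, v}" "u \<in> verts G" "v \<in> verts G" by (rule wf_edgeE)
  then show "\<exists>u v. u \<noteq> v \<and> e = {u, v} \<and> u \<in> verts (induced G S) \<and> v \<in> verts (induced G S)"
    using e(2) by (intro exI[of _ u] exI[of _ v]) (auto simp: induced_def)
qed

theorem theorem4p7:
  fixes G :: "'a graph" and m n :: nat
  assumes "wf_graph G"
    and "1 \<le> n" and "n \<le> m"
    and "\<not> chordal G"
    and "\<not> contains_join G m n"
    and "enat (clique_num (induced G (Omega G))) + nc_index G \<le> enat m"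
  shows "(\<exists>Gs. chordal_completion G Gs \<and> clique_num Gs < m + n) \<and> chi_DP G < m + n"
proof -
  have wf: "wf_graph G" by fact
  have "nc_index G \<noteq> \<infinity>" using assms(6) by (cases "nc_index G") auto
  then obtain C Cs where p: "local_chordalization_partition G C Cs" "nc_index G = enat (length Cs)"
    using nc_index_attained[OF assms(4)] by metis
  have le: "clique_num (induced G (Omega G)) + length Cs \<le> m" using assms(6) p(2) by simp
  obtain Gt where Gt: "chordal_completion G Gt" "\<forall>e\<in>edges Gt. e \<notin> edges G \<longrightarrow> e \<subseteq> Omega G"
    "\<forall>K. is_clique Gt K \<longrightarrow> (\<exists>U. finite U \<and> card U \<le> length Cs \<and> is_clique G (K - U))"
    using partition_completion[OF wf p(1)] by blast
  have wft: "wf_graph Gt" "verts Gt = verts G" using Gt(1) unfolding chordal_completion_def by blast+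
  have "clique_num Gt < m + n"
  proof (rule ccontr)
    assume "\<not> ?thesis"
    then obtain K where K: "is_clique Gt K" "m + n \<le> card K"
      using clique_num_attained[OF wft(1)] by (metis linorder_not_less)
    have KV: "K \<subseteq> verts G" using K(1) wft(2) unfolding is_clique_def by simp
    then have fK: "finite K" using wf finite_subset unfolding wf_graph_def by blast
    obtain U where U: "finite U" "card U \<le> length Cs" "is_clique G (K - U)" using Gt(3) K(1) by blast
    \<comment> \<open>Inside \<open>Omega G\<close>, the clique \<open>K\<close> consists of a
      clique of \<open>G\<close> and at most \<open>length Cs\<close> deleted vertices, hence has at
      most \<open>m\<close> vertices there.\<close>
    have "is_clique (induced G (Omega G)) ((K - U) \<inter> Omega G)"
      using U(3) unfolding is_clique_def induced_def adj_def by auto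
    then have "card ((K - U) \<inter> Omega G) \<le> clique_num (induced G (Omega G))"
      by (rule clique_le_clique_num[OF wf_induced[OF wf]])
    moreover have "card (K \<inter> Omega G) \<le> card ((K - U) \<inter> Omega G \<union> U)"
      using fK U(1) by (intro card_mono) auto
    moreover have "card ((K - U) \<inter> Omega G \<union> U) \<le> card ((K - U) \<inter> Omega G) + card U"
      by (rule card_Un_le)
    ultimately have "card (K \<inter> Omega G) \<le> m" using le U(2) by linarith
    moreover have "card K = card (K \<inter> Omega G) + card (K - Omega G)"
      using fK by (metis card_Int_Diff)
    ultimately have "n \<le> card (K - Omega G)" using K(2) by linarith
    \<comment> \<open>\<open>B\<close> lies outside \<open>Omega G\<close>, where no new edge ends:
      all edges of the clique \<open>K\<close> with an end in \<open>B\<close> are edges of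
      \<open>G\<close>.\<close>
    then obtain B where B: "B \<subseteq> K - Omega G" "card B = n" using fK by (meson obtain_subset_with_card_n)
    have fB: "finite B" using B(1) fK finite_subset by blast
    have "card (K - B) = card K - n" using B fB by (metis Diff_subset card_Diff_subset subset_trans)
    then have "m \<le> card (K - B)" using K(2) by linarith
    \<comment> \<open>Any \<open>m\<close> of the remaining vertices serve as the \<open>I_m\<close>
      side: \<open>contains_join\<close> asks for a subgraph that may have further edges inside
      \<open>A\<close>.\<close>
    then obtain A where A: "A \<subseteq> K - B" "card A = m" by (meson obtain_subset_with_card_n)
    have a: "adj G x b" if "x \<in> K" "b \<in> B" "x \<noteq> b" for x b
    proof -
      have "adj Gt x b" using K(1) that B(1) unfolding is_clique_def by blast
      then show ?thesis using Gt(2) that B(1) unfolding adj_def by blast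
    qed
    have "is_clique G B" using a B(1) KV unfolding is_clique_def by blast
    moreover have "\<forall>x\<in>A. \<forall>b\<in>B. adj G x b" using a A(1) by blast
    ultimately have "contains_join G m n"
      unfolding contains_join_def using A B KV by (intro exI[of _ A] exI[of _ B]) blast
    then show False using assms(5) by simp
  qed
  then show ?thesis using Gt(1) chi_DP_le_chordal_completion[OF wf Gt(1)] by (meson le_less_trans)
qed

end
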